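(* Let $f,g_1,\dots,g_m\in\mathbb{R}[x]$, $g=(g_1,\dots,g_m)$ and $f^\star:=\inf_{x\in S(g)}f(x)$. Assume that the problem $\inf_{x\in S(g)}f(x)$ has at least one global minimizer, and that one of the following conditions holds: 1. $g=(1-x_1^2-\dots-x_n^2)$ (so $m=1$); 2. $g=(1-x_1^2,\dots,1-x_n^2)$ (so $m=n$); 3. $g=(x_1,\dots,x_n,1-x_1-\dots-x_n)$ (so $m=n+1$). Then there exists $k\in\mathbb{N}$ such that $\rho_k(f,g,h_{\mathrm{FJ}})=f^\star$.
   Context: Let $n,m\ge1$, $x=(x_1,\dots,x_n)$, $\bar\lambda:=(\lambda_0,\dots,\lambda_m)$; polynomials in $x$ are also regarded as polynomials in $z:=(x,\bar\lambda)$. $\nabla p$ is the (column) gradient with respect to $x$. $S(g):=\{x\in\mathbb{R}^n : g_j(x)\ge 0,\ j=1,\dots,m\}$. The tuple $h_{\mathrm{FJ}}$ of $n+m+1$ polynomials in $\mathbb{R}[z]$ is $$h_{\mathrm{FJ}}:=\Big(\lambda_0\nabla f-\sum_{j=1}^m\lambda_j\nabla g_j,\ \lambda_1g_1,\dots,\lambda_mg_m,\ 1-\sum_{j=0}^m\lambda_j^2\Big).$$ $\Sigma^2[z]$ is the cone of sums of squares of polynomials in $\mathbb{R}[z]$. For $k\in\mathbb{N}$ and a tuple $h=(h_1,\dots,h_l)$ in $\mathbb{R}[z]$, $$Q_k(g)[z]:=\Big\{\sigma_0+\sum_{j=1}^m\sigma_jg_j : \sigma_j\in\Sigma^2[z],\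 \deg\sigma_0\le 2k,\ \deg(\sigma_jg_j)\le 2k\Big\},$$ $$I_k(h)[z]:=\Big\{\sum_{t=1}^l\psi_th_t : \psi_t\in\mathbb{R}[z],\ \deg(\psi_th_t)\le 2k\Big\},$$ $$\rho_k(f,g,h):=\sup\{\xi\in\mathbb{R} : f-\xi\in Q_k(g)[z]+I_k(h)[z]\}.$$ *)

theory Defs
  imports "HOL-Library.Extended_Real" "HOL-Library.Poly_Mapping" "HOL-Library.FuncSet" "HOL-Library.Set_Algebras"
begin

text \<open>
  Real polynomials in the variables \<open>0, 1, 2, \<dots>\<close>: finitely supported maps from exponent vectors
  to coefficients, with the (convolution) ring structure of \<^theory>\<open>HOL-Library.Poly_Mapping\<close>.
  The polynomial ring in the first \<open>N\<close> variables is the carrier \<open>polys N\<close>, so that a polynomial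
  in \<open>x\<close> literally is a polynomial in \<open>z\<close>.
\<close>

type_synonym monom = "nat \<Rightarrow>\<^sub>0 nat"
type_synonym mpoly = "monom \<Rightarrow>\<^sub>0 real"

definition polys :: "nat \<Rightarrow> mpoly set" where
  "polys N = {p. \<forall>a \<in> Poly_Mapping.keys p. Poly_Mapping.keys a \<subseteq> {..<N}}"

definition Const :: "real \<Rightarrow> mpoly" where
  "Const c = Poly_Mapping.single 0 c"

definition Var :: "nat \<Rightarrow> mpoly" where
  "Var i = Poly_Mapping.single (Poly_Mapping.single i 1) 1"

definition eval :: "(nat \<Rightarrow> real) \<Rightarrow> mpoly \<Rightarrow> real" where
  "eval x p = (\<Sum>a\<in>Poly_Mapping.keys p. Poly_Mapping.lookup p a * (\<Prod>i\<in>Poly_Mapping.keys a. x i ^ Poly_Mapping.lookup a i))"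

text \<open>
  The total degree, with degree \<open>0\<close> for the zero polynomial. Degrees occur below only in bounds
  of the form \<open>\<le> 2 * k\<close>, so the convention for the zero polynomial is immaterial.
\<close>

definition tdeg :: "mpoly \<Rightarrow> nat" where
  "tdeg p = Max (insert 0 ((\<lambda>a. \<Sum>i\<in>Poly_Mapping.keys a. Poly_Mapping.lookup a i) ` Poly_Mapping.keys p))"

text \<open>
  In the next definition, subtraction of exponents is truncated if \<open>i\<close> does not occur in
  the monomial \<open>a\<close>, but then the coefficient is zero.
\<close>

definition pdiff :: "nat \<Rightarrow> mpoly \<Rightarrow> mpoly" where
  "pdiff i p = (\<Sum>a\<in>Poly_Mapping.keys p.
     Poly_Mapping.single (a - Poly_Mapping.single i 1) (real (Poly_Mapping.lookup a i) * Poly_Mapping.lookup p a))"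

text \<open>
  The tuple of constraints is a list \<open>g\<close>, its length being the number \<open>m\<close> of constraints;
  \<open>g ! j\<close> with \<open>j < m\<close> is the constraint with number \<open>j + 1\<close>.
  Points of \<open>n\<close>-space are functions on \<open>{..<n}\<close>, extended by \<open>undefined\<close>.
\<close>

definition S :: "nat \<Rightarrow> mpoly list \<Rightarrow> (nat \<Rightarrow> real) set" where
  "S n g = {x \<in> {..<n} \<rightarrow>\<^sub>E UNIV. \<forall>j<length g. eval x (g ! j) \<ge> 0}"

definition fstar :: "nat \<Rightarrow> mpoly \<Rightarrow> mpoly list \<Rightarrow> ereal" where
  "fstar n f g = (INF x \<in> S n g. ereal (eval x f))"

definition global_minimizer :: "nat \<Rightarrow> mpoly \<Rightarrow> mpoly list \<Rightarrow> (nat \<Rightarrow> real) \<Rightarrow> bool" where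
  "global_minimizer n f g x \<longleftrightarrow> x \<in> S n g \<and> (\<forall>y \<in> S n g. eval x f \<le> eval y f)"

text \<open>
  The variables of \<open>z\<close> are \<open>x\<close>, numbered \<open>0, \<dots>, n - 1\<close>, followed by the multipliers
  \<open>\<lambda>\<^sub>0, \<dots>, \<lambda>\<^sub>m\<close>, numbered \<open>n, \<dots>, n + m\<close>.
\<close>

definition nz :: "nat \<Rightarrow> mpoly list \<Rightarrow> nat" where
  "nz n g = n + length g + 1"

definition Lam :: "nat \<Rightarrow> nat \<Rightarrow> mpoly" where
  "Lam n j = Var (n + j)"

definition h_FJ :: "nat \<Rightarrow> mpoly \<Rightarrow> mpoly list \<Rightarrow> mpoly list" where
  "h_FJ n f g =
     map (\<lambda>i. Lam n 0 * pdiff i f - (\<Sum>j<length g. Lam n (j + 1) * pdiff i (g ! j))) [0..<n]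
     @ map (\<lambda>j. Lam n (j + 1) * g ! j) [0..<length g]
     @ [1 - (\<Sum>j\<le>length g. (Lam n j)\<^sup>2)]"

definition SOS :: "nat \<Rightarrow> mpoly set" where
  "SOS N = {\<Sum>i<r. (q i)\<^sup>2 | (r::nat) q. \<forall>i<r. q i \<in> polys N}"

text \<open>In the next two definitions, \<open>N\<close> is the number of variables of the ambient ring.\<close>

definition Q :: "nat \<Rightarrow> nat \<Rightarrow> mpoly list \<Rightarrow> mpoly set" where
  "Q N k g = {\<sigma>0 + (\<Sum>j<length g. \<sigma> j * g ! j) | \<sigma>0 \<sigma>.
     \<sigma>0 \<in> SOS N \<and> tdeg \<sigma>0 \<le> 2 * k \<and>
     (\<forall>j<length g. \<sigma> j \<in> SOS N \<and> tdeg (\<sigma> j * g ! j) \<le> 2 * k)}"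

definition I :: "nat \<Rightarrow> nat \<Rightarrow> mpoly list \<Rightarrow> mpoly set" where
  "I N k h = {\<Sum>t<length h. \<psi> t * h ! t | \<psi>.
     \<forall>t<length h. \<psi> t \<in> polys N \<and> tdeg (\<psi> t * h ! t) \<le> 2 * k}"

text \<open>The supremum is taken in the extended reals: it is \<open>-\<infinity>\<close> if no \<open>\<xi>\<close> is feasible.\<close>

definition rho :: "nat \<Rightarrow> nat \<Rightarrow> mpoly \<Rightarrow> mpoly list \<Rightarrow> mpoly list \<Rightarrow> ereal" where
  "rho n k f g h = (SUP \<xi> \<in> {\<xi>::real. f - Const \<xi> \<in> Q (nz n g) k g + I (nz n g) k h}. ereal \<xi>)"

end

(*
  Let K be a formally real field containing R. If the
  Fritz John relations lambda_0 grad f = sum lambda_j grad g_j, lambda_j g_j = 0 hold at a K-point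
  with lambda_0 /= 0, then every derivation of K over R kills f (as either lambda_j = 0 or g_j = 0
  in K), so f is algebraic over R, hence a real constant. For the three sets of constraints,
  lambda_0 = 0 is impossible at any point over a field. A quadratic module that is maximal among
  those avoiding -t^2, t a product of factors f - c with c >= f_min, has a real prime ideal as its
  support, so that f becomes a constant c; c >= f_min contradicts the choice of the module, and c < f_min
  contradicts minimality at the real point which the archimedean property provides.
  So -t^2 belongs to the quadratic module of g plus the ideal of h_FJ for some such t. Now interpolate
  sqrt (c - f_min) at the zeros of t by a polynomial q: u = f - f_min - q(f)^2 has a power divisible
  by t, and f - f_min + eps = q(f)^2 + (eps + u + C u^K) + C (-u^K), where the middle term is a sum of
  squares for large C. The degrees do not depend on eps.
*)
theory Submission
  imports Defs "HOL-Computational_Algebra.Fundamental_Theorem_Algebra"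
begin

subsection \<open>Polynomials\<close>

text \<open>The inequality \<open>rho \<le> fstar\<close> needs a real zero of \<open>h_FJ\<close>
  over the minimizer: if the ideal contained 1, \<open>rho\<close> could be infinite. For each shape
  of \<open>g\<close> such a zero is built by hand from first-order feasible directions, with a
  nonzero multiplier of \<open>f\<close>, and scaled to the unit sphere. For the other inequality no
  finiteness theorem for critical values is used. The maximal module sees one critical value at a
  time; forbidding \<open>- (t\<^sup>2)\<close> for all finite products \<open>t\<close> of factors
  \<open>f - c\<close> yields a finite list of values at once. It also makes the forbidden set
  multiplicatively closed, on which primality of the support rests. A quadratic module need not be
  closed under products, so wherever two of its elements would be multiplied, an identity with
  square multipliers takes over. The field of the overview is the fraction field of the residue ring
  modulo the support. It is never constructed: equality means congruence modulo the prime ideal, and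
  denominators are cleared by rescaling the derivation. The last entry of \<open>h_FJ\<close> bounds
  the multipliers, so that the module is archimedean in all variables of z and not only in
  x.\<close>

lemma Const_add: "Const (a + b) = Const a + Const b"
  and Const_mult: "Const (a * b) = Const a * Const b"
  and Const_0 [simp]: "Const 0 = 0"
  and Const_1 [simp]: "Const 1 = 1"
  and Const_minus: "Const (- a) = - Const a"
  and Const_diff: "Const (a - b) = Const a - Const b"
  by (simp_all add: Const_def single_add mult_single single_uminus single_diff)

lemma Const_power: "Const (a ^ k) = Const a ^ k"
  by (induction k) (simp_all add: Const_mult)

lemma Const_numeral: "Const (numeral k) = numeral k"
  by (simp add: Const_def)

lemma sum_single_keys:
  fixes a :: "'a \<Rightarrow>\<^sub>0 'b::comm_monoid_add"
  shows "(\<Sum>i\<in>Poly_Mapping.keys a. Poly_Mapping.single i (Poly_Mapping.lookup a i)) = a"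
  by (rule poly_mapping_eqI)
    (auto simp: lookup_sum lookup_single when_def sum.delta in_keys_iff)

lemma Var_power: "Var i ^ k = Poly_Mapping.single (Poly_Mapping.single i k) 1"
  by (induction k) (simp_all add: Var_def mult_single flip: single_add)

lemma prod_single_1:
  "finite F \<Longrightarrow> (\<Prod>i\<in>F. Poly_Mapping.single (h i) (1::real)) = Poly_Mapping.single (\<Sum>i\<in>F. h i :: monom) 1"
  by (induction F rule: finite_induct) (simp_all add: mult_single)

lemma single_eq_Const_Var:
  "Poly_Mapping.single a c = Const c * (\<Prod>i\<in>Poly_Mapping.keys a. Var i ^ Poly_Mapping.lookup a i)"
  by (simp add: Var_power prod_single_1 sum_single_keys Const_def mult_single)

lemma polys_sum_single_induct:
  assumes "p \<in> polys N"
    and "\<And>a c. Poly_Mapping.keys a \<subseteq> {..<N} \<Longrightarrow> P (Poly_Mapping.single a c)"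
    and "\<And>p q. P p \<Longrightarrow> P q \<Longrightarrow> P (p + q)"
  shows "P p"
proof -
  have z: "P 0" using assms(2)[of 0 0] by simp
  have "P (\<Sum>a\<in>F. Poly_Mapping.single a (Poly_Mapping.lookup p a))"
    if "finite F" "F \<subseteq> Poly_Mapping.keys p" for F
    using that
  proof (induction F rule: finite_induct)
    case (insert a F)
    then have "Poly_Mapping.keys a \<subseteq> {..<N}" using assms(1) by (auto simp: polys_def)
    with insert assms show ?case by simp
  qed (simp add: z)
  from this[of "Poly_Mapping.keys p"] show ?thesis by (simp add: sum_single_keys)
qed

lemma polys_induct [consumes 1, case_names Const Var add mult]:
  assumes "p \<in> polys N"
    and C: "\<And>c. P (Const c)" and V: "\<And>i. i < N \<Longrightarrow> P (Var i)"
    and A: "\<And>p q. P p \<Longrightarrow> P q \<Longrightarrow> P (p + q)" and M: "\<And>p q. P p \<Longrightarrow> P q \<Longrightarrow> P (p * q)"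
  shows "P p"
  using assms(1)
proof (rule polys_sum_single_induct)
  fix a c assume a: "Poly_Mapping.keys (a::monom) \<subseteq> {..<N}"
  have pw: "P (Var i ^ k)" if "i < N" for i k
    by (induction k) (use C[of 1] M V that in auto)
  have "P (\<Prod>i\<in>F. Var i ^ Poly_Mapping.lookup a i)"
    if "finite F" "F \<subseteq> Poly_Mapping.keys a" for F
    using that by (induction F rule: finite_induct) (use a C[of 1] M pw in auto)
  then show "P (Poly_Mapping.single a c)"
    unfolding single_eq_Const_Var by (intro M C) auto
qed (use A in auto)

lemma in_polys_ex: "\<exists>N. p \<in> polys N"
proof -
  let ?U = "\<Union>a\<in>Poly_Mapping.keys p. Poly_Mapping.keys a"
  have "finite ?U" by simp
  then obtain N where "?U \<subseteq> {..<N}" using finite_nat_iff_bounded by blast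
  then show ?thesis by (auto simp: polys_def)
qed

lemma mpoly_induct [case_names Const Var add mult]:
  assumes "\<And>c. P (Const c)" "\<And>i. P (Var i)"
    and "\<And>p q. P p \<Longrightarrow> P q \<Longrightarrow> P (p + q)" and "\<And>p q. P p \<Longrightarrow> P q \<Longrightarrow> P (p * q)"
  shows "P p"
  using in_polys_ex[of p] assms polys_induct[of p _ P] by metis

lemma polys_Const [simp]: "Const c \<in> polys N"
  by (simp add: polys_def Const_def)

lemma polys_0 [simp]: "0 \<in> polys N" and polys_1 [simp]: "1 \<in> polys N"
  using polys_Const[of 0] polys_Const[of 1] by simp_all

lemma polys_Var [simp]: "i < N \<Longrightarrow> Var i \<in> polys N"
  by (simp add: polys_def Var_def)

lemma polys_add [simp]: "p \<in> polys N \<Longrightarrow> q \<in> polys N \<Longrightarrow> p + q \<in> polys N"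
  using keys_add[of p q] by (auto simp: polys_def)

lemma polys_mult [simp]: "p \<in> polys N \<Longrightarrow> q \<in> polys N \<Longrightarrow> p * q \<in> polys N"
proof -
  assume p: "p \<in> polys N" and q: "q \<in> polys N"
  have "Poly_Mapping.keys (a + b) \<subseteq> {..<N}"
    if "a \<in> Poly_Mapping.keys p" "b \<in> Poly_Mapping.keys q" for a b
    using that p q keys_add[of a b] by (fastforce simp: polys_def)
  then show ?thesis using keys_mult[of p q] by (fastforce simp: polys_def)
qed

lemma polys_uminus [simp]: "p \<in> polys N \<Longrightarrow> - p \<in> polys N"
  using polys_mult[OF polys_Const[of "- 1"], of p N] by (simp add: Const_minus)

lemma polys_diff [simp]: "p \<in> polys N \<Longrightarrow> q \<in> polys N \<Longrightarrow> p - q \<in> polys N"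
  using polys_add[of p N "- q"] by simp

lemma polys_power [simp]: "p \<in> polys N \<Longrightarrow> p ^ k \<in> polys N"
  by (induction k) simp_all

lemma polys_sum: "(\<And>i. i \<in> F \<Longrightarrow> h i \<in> polys N) \<Longrightarrow> sum h F \<in> polys N"
  by (induction F rule: infinite_finite_induct) simp_all

lemma polys_mono: "M \<le> N \<Longrightarrow> p \<in> polys M \<Longrightarrow> p \<in> polys N"
  by (fastforce simp: polys_def)

text \<open>The map \<open>c\<close> on coefficients lets one development serve both evaluation at
  real points (\<open>c\<close> the identity) and substitution of polynomials for variables
  (\<open>c = Const\<close>).\<close>

definition subst :: "(real \<Rightarrow> 'b) \<Rightarrow> (nat \<Rightarrow> 'b::comm_ring_1) \<Rightarrow> mpoly \<Rightarrow> 'b" where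
  "subst c v p = (\<Sum>a\<in>Poly_Mapping.keys p. c (Poly_Mapping.lookup p a) *
     (\<Prod>i\<in>Poly_Mapping.keys a. v i ^ Poly_Mapping.lookup a i))"

locale scalar_hom =
  fixes c :: "real \<Rightarrow> 'b::comm_ring_1"
  assumes hom_add: "c (x + y) = c x + c y" and hom_mult: "c (x * y) = c x * c y"
    and hom_1: "c 1 = 1"
begin

lemma hom_0: "c 0 = 0"
  using hom_add[of 0 0] by simp

lemma subst_add: "subst c v (p + q) = subst c v p + subst c v q"
  unfolding subst_def
  by (rule setsum_keys_plus_distrib) (simp_all add: hom_0 hom_add distrib_right)

lemma subst_single:
  "subst c v (Poly_Mapping.single a r) = c r * (\<Prod>i\<in>Poly_Mapping.keys a. v i ^ Poly_Mapping.lookup a i)"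
  by (simp add: subst_def hom_0)

lemma subst_Const: "subst c v (Const r) = c r"
  and subst_Var: "subst c v (Var i) = v i"
  by (simp_all add: Const_def Var_def subst_single hom_1)

text \<open>All three products are extended to the union of the supports, where the additional
  exponents are 0 and contribute the factor 1.\<close>

lemma prod_monom_add:
  fixes a b :: monom
  shows "(\<Prod>i\<in>Poly_Mapping.keys (a + b). v i ^ Poly_Mapping.lookup (a + b) i) =
    (\<Prod>i\<in>Poly_Mapping.keys a. (v i::'b) ^ Poly_Mapping.lookup a i) *
    (\<Prod>i\<in>Poly_Mapping.keys b. v i ^ Poly_Mapping.lookup b i)"
proof -
  let ?F = "Poly_Mapping.keys a \<union> Poly_Mapping.keys b"
  have e: "(\<Prod>i\<in>Poly_Mapping.keys e. v i ^ Poly_Mapping.lookup e i) = (\<Prod>i\<in>?F. v i ^ Poly_Mapping.lookup e i)"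
    if "Poly_Mapping.keys e \<subseteq> ?F" for e
    by (rule prod.mono_neutral_left) (use that in \<open>auto simp: in_keys_iff\<close>)
  show ?thesis
    unfolding e[OF keys_add] e[OF Un_upper1] e[OF Un_upper2]
    by (simp add: lookup_add power_add prod.distrib)
qed

lemma subst_mult: "subst c v (p * q) = subst c v p * subst c v q"
proof -
  obtain N M where p: "p \<in> polys N" and q: "q \<in> polys M" using in_polys_ex by metis
  show ?thesis using p
  proof (rule polys_sum_single_induct)
    fix a r
    show "subst c v (Poly_Mapping.single a r * q) = subst c v (Poly_Mapping.single a r) * subst c v q"
      using q
      by (rule polys_sum_single_induct)
        (simp_all add: mult_single subst_single prod_monom_add hom_mult subst_add distrib_left distrib_right mult_ac)
  qed (simp add: distrib_right subst_add)
qed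

lemma subst_0: "subst c v 0 = 0" and subst_1: "subst c v 1 = 1"
  using subst_Const[of v 0] subst_Const[of v 1] by (simp_all add: hom_0 hom_1)

lemma subst_uminus: "subst c v (- p) = - subst c v p"
  using subst_add[of v p "- p"] by (simp add: subst_0 eq_neg_iff_add_eq_0 add.commute)

lemma subst_diff: "subst c v (p - q) = subst c v p - subst c v q"
  using subst_add[of v p "- q"] by (simp add: subst_uminus)

lemma subst_power: "subst c v (p ^ k) = subst c v p ^ k"
  by (induction k) (simp_all add: subst_1 subst_mult)

lemma subst_sum: "subst c v (sum h F) = (\<Sum>i\<in>F. subst c v (h i))"
  by (induction F rule: infinite_finite_induct) (simp_all add: subst_0 subst_add)

lemmas subst_simps = subst_add subst_mult subst_0 subst_1 subst_uminus subst_diff subst_power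
  subst_sum subst_Const subst_Var

end

interpretation eval: scalar_hom "\<lambda>r::real. r"
  by unfold_locales simp_all

interpretation Const: scalar_hom Const
  by unfold_locales (simp_all add: Const_add Const_mult)

lemma eval_eq_subst: "eval x p = subst (\<lambda>r. r) x p"
  by (simp add: eval_def subst_def)

lemmas eval_simps = eval.subst_simps[folded eval_eq_subst]

lemma eval_cong:
  assumes "p \<in> polys N" "\<And>i. i < N \<Longrightarrow> x i = y i"
  shows "eval x p = eval y p"
  using assms(1) by (induction rule: polys_induct) (simp_all add: eval_simps assms(2))

section \<open>Formal partial derivatives and degrees\<close>

lemma pdiff_single:
  "pdiff i (Poly_Mapping.single a c) =
     Poly_Mapping.single (a - Poly_Mapping.single i 1) (real (Poly_Mapping.lookup a i) * c)"
  by (simp add: pdiff_def)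

lemma pdiff_add: "pdiff i (p + q) = pdiff i p + pdiff i q"
  unfolding pdiff_def
  by (rule setsum_keys_plus_distrib) (simp_all add: distrib_left single_add)

text \<open>Positivity of the exponent rules out truncation. In the product rule the other case is
  harmless: the two monomials may differ, but both carry the coefficient 0.\<close>

lemma monom_diff_add:
  fixes a b :: monom
  assumes "Poly_Mapping.lookup a i > 0"
  shows "a + b - Poly_Mapping.single i 1 = (a - Poly_Mapping.single i 1) + b"
  by (rule poly_mapping_eqI)
    (use assms in \<open>auto simp: lookup_add lookup_minus lookup_single when_def\<close>)

lemma pdiff_mult: "pdiff i (p * q) = pdiff i p * q + p * pdiff i q"
proof -
  obtain N M where p: "p \<in> polys N" and q: "q \<in> polys M" using in_polys_ex by metis
  have s: "pdiff i (Poly_Mapping.single a r * Poly_Mapping.single b s) =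
      pdiff i (Poly_Mapping.single a r) * Poly_Mapping.single b s
      + Poly_Mapping.single a r * pdiff i (Poly_Mapping.single b s)" for a b r s
  proof -
    have 1: "Poly_Mapping.single (a + b - Poly_Mapping.single i 1) (real (Poly_Mapping.lookup a i) * (r * s))
      = Poly_Mapping.single (a - Poly_Mapping.single i 1 + b) (real (Poly_Mapping.lookup a i) * (r * s))"
      using monom_diff_add[of a i b] by (cases "Poly_Mapping.lookup a i = 0") auto
    have 2: "Poly_Mapping.single (a + b - Poly_Mapping.single i 1) (real (Poly_Mapping.lookup b i) * (r * s))
      = Poly_Mapping.single (a + (b - Poly_Mapping.single i 1)) (real (Poly_Mapping.lookup b i) * (r * s))"
      using monom_diff_add[of b i a] by (cases "Poly_Mapping.lookup b i = 0") (auto simp: add.commute)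
    show ?thesis
      using 1 2 by (simp add: mult_single pdiff_single lookup_add distrib_left distrib_right single_add ac_simps)
  qed
  show ?thesis using p
  proof (rule polys_sum_single_induct)
    fix a r
    show "pdiff i (Poly_Mapping.single a r * q) =
        pdiff i (Poly_Mapping.single a r) * q + Poly_Mapping.single a r * pdiff i q"
      using q by (rule polys_sum_single_induct) (simp_all add: s pdiff_add algebra_simps)
  qed (simp add: algebra_simps pdiff_add)
qed

lemma pdiff_Const [simp]: "pdiff i (Const c) = 0"
  by (simp add: Const_def pdiff_single)

lemma pdiff_0 [simp]: "pdiff i 0 = 0" and pdiff_1 [simp]: "pdiff i 1 = 0"
  using pdiff_Const[of i 0] pdiff_Const[of i 1] by simp_all

lemma pdiff_Var: "pdiff i (Var j) = (if i = j then 1 else 0)"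
  by (simp add: Var_def pdiff_single lookup_single when_def)

lemma pdiff_uminus: "pdiff i (- p) = - pdiff i p"
  using pdiff_add[of i p "- p"] by (simp add: eq_neg_iff_add_eq_0 add.commute)

lemma pdiff_diff: "pdiff i (p - q) = pdiff i p - pdiff i q"
  using pdiff_add[of i p "- q"] by (simp add: pdiff_uminus)

lemma pdiff_sum: "pdiff i (sum h F) = (\<Sum>j\<in>F. pdiff i (h j))"
  by (induction F rule: infinite_finite_induct) (simp_all add: pdiff_add)

lemma pdiff_power2: "pdiff i (p\<^sup>2) = 2 * p * pdiff i p"
  by (simp add: power2_eq_square pdiff_mult)

lemmas pdiff_simps = pdiff_add pdiff_mult pdiff_Var pdiff_uminus pdiff_diff pdiff_sum pdiff_power2

lemma pdiff_polys: "p \<in> polys N \<Longrightarrow> pdiff i p \<in> polys N"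
  by (rule polys_induct[of p N "\<lambda>p. p \<in> polys N \<and> pdiff i p \<in> polys N", THEN conjunct2])
    (simp_all add: pdiff_simps)

lemma tdeg_le_iff:
  "tdeg p \<le> d \<longleftrightarrow> (\<forall>a\<in>Poly_Mapping.keys p. (\<Sum>i\<in>Poly_Mapping.keys a. Poly_Mapping.lookup a i) \<le> d)"
  by (simp add: tdeg_def)

lemma tdeg_add_le: "tdeg p \<le> d \<Longrightarrow> tdeg q \<le> d \<Longrightarrow> tdeg (p + q) \<le> d"
  using keys_add[of p q] by (auto simp: tdeg_le_iff)

lemma tdeg_Const [simp]: "tdeg (Const c) = 0"
  by (simp add: tdeg_def Const_def)

lemma tdeg_Const_mult_le: "tdeg p \<le> d \<Longrightarrow> tdeg (Const c * p) \<le> d"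
  using keys_mult[of "Const c" p] by (cases "c = 0") (auto simp: tdeg_le_iff Const_def)

subsection \<open>Quadratic modules\<close>

definition qmodule :: "mpoly set \<Rightarrow> bool" where
  "qmodule M \<longleftrightarrow> 1 \<in> M \<and> (\<forall>a\<in>M. \<forall>b\<in>M. a + b \<in> M) \<and> (\<forall>a\<in>M. \<forall>s. s\<^sup>2 * a \<in> M)"

lemma qmodule_add: "qmodule M \<Longrightarrow> a \<in> M \<Longrightarrow> b \<in> M \<Longrightarrow> a + b \<in> M"
  and qmodule_sq_mult: "qmodule M \<Longrightarrow> a \<in> M \<Longrightarrow> s\<^sup>2 * a \<in> M"
  and qmodule_1: "qmodule M \<Longrightarrow> 1 \<in> M"
  by (auto simp: qmodule_def)

lemma qmodule_sq: "qmodule M \<Longrightarrow> s\<^sup>2 \<in> M"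
  using qmodule_sq_mult[OF _ qmodule_1, of M s] by simp

lemma qmodule_0: "qmodule M \<Longrightarrow> 0 \<in> M"
  using qmodule_sq[of M 0] by simp

lemma qmodule_Const_mult: "qmodule M \<Longrightarrow> a \<in> M \<Longrightarrow> c \<ge> 0 \<Longrightarrow> Const c * a \<in> M"
  using qmodule_sq_mult[of M a "Const (sqrt c)"] by (simp flip: Const_power)

lemma qmodule_Const: "qmodule M \<Longrightarrow> c \<ge> 0 \<Longrightarrow> Const c \<in> M"
  using qmodule_Const_mult[OF _ qmodule_1, of M c] by simp

lemma qmodule_sum: "qmodule M \<Longrightarrow> (\<And>i. i \<in> F \<Longrightarrow> h i \<in> M) \<Longrightarrow> sum h F \<in> M"
  by (induction F rule: infinite_finite_induct) (auto simp: qmodule_0 qmodule_add)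

definition supp :: "mpoly set \<Rightarrow> mpoly set" where
  "supp M = {a. a \<in> M \<and> - a \<in> M}"

lemma supp_add: "qmodule M \<Longrightarrow> a \<in> supp M \<Longrightarrow> b \<in> supp M \<Longrightarrow> a + b \<in> supp M"
  using qmodule_add[of M a b] qmodule_add[of M "- a" "- b"] by (simp add: supp_def)

text \<open>Every ring element is a difference of two squares, namely those of
  \<open>(a + 1) / 2\<close> and \<open>(a - 1) / 2\<close>. Hence stability under square
  multipliers makes \<open>supp M\<close> an ideal.\<close>

lemma mult_eq_diff_sq:
  "(a::mpoly) * b = (Const (1/2) * (a + 1))\<^sup>2 * b + (Const (1/2) * (a - 1))\<^sup>2 * (- b)"
proof -
  have "Const (1/2) * Const (1/2) * 4 = Const (1/2 * (1/2) * 4)"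
    by (simp only: Const_mult Const_numeral)
  then have h: "Const (1/2) * Const (1/2) * 4 = 1" by simp
  have "(Const (1/2) * (a + 1))\<^sup>2 * b + (Const (1/2) * (a - 1))\<^sup>2 * (- b)
    = (Const (1/2) * Const (1/2) * 4) * (a * b)"
    by (simp add: power2_eq_square algebra_simps)
  then show ?thesis by (simp add: h)
qed

lemma supp_mult:
  assumes M: "qmodule M" and b: "b \<in> supp M"
  shows "a * b \<in> supp M"
proof -
  have "a * b \<in> M" if "b \<in> M" "- b \<in> M" for b
    unfolding mult_eq_diff_sq[of a b] using M that by (intro qmodule_add qmodule_sq_mult)
  from this[of b] this[of "- b"] b show ?thesis by (simp add: supp_def)
qed

definition prime_ideal :: "mpoly set \<Rightarrow> bool" where
  "prime_ideal P \<longleftrightarrow> 1 \<notin> P \<and> 0 \<in> P \<and> (\<forall>a\<in>P. \<forall>b\<in>P. a + b \<in> P) \<and> (\<forall>a. \<forall>b\<in>P. a * b \<in> P)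
     \<and> (\<forall>a b. a * b \<in> P \<longrightarrow> a \<in> P \<or> b \<in> P)"

section \<open>Maximal quadratic modules avoiding a multiplicative set\<close>

text \<open>With \<open>T = {1}\<close> these are the maximal proper quadratic modules. A larger
  \<open>T\<close> also keeps its elements out of the support, which is how certain values of
  \<open>f\<close> get excluded.\<close>

locale maximal_qmodule =
  fixes T N :: "mpoly set"
  assumes T_1: "1 \<in> T" and T_mult: "t \<in> T \<Longrightarrow> u \<in> T \<Longrightarrow> t * u \<in> T"
    and N: "qmodule N" and avoid: "t \<in> T \<Longrightarrow> - (t\<^sup>2) \<notin> N"
    and maximal: "qmodule N' \<Longrightarrow> N \<subseteq> N' \<Longrightarrow> (\<And>t. t \<in> T \<Longrightarrow> - (t\<^sup>2) \<notin> N') \<Longrightarrow> N' = N"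
begin

text \<open>Dividing by squares of elements of \<open>T\<close> gives a quadratic module that
  contains \<open>N\<close> and, \<open>T\<close> being closed under products, still avoids every
  \<open>- (t\<^sup>2)\<close>. By maximality it is \<open>N\<close>.\<close>

lemma saturated:
  assumes "t \<in> T" "t\<^sup>2 * a \<in> N"
  shows "a \<in> N"
proof -
  let ?N = "{a. \<exists>t\<in>T. t\<^sup>2 * a \<in> N}"
  have "qmodule ?N" unfolding qmodule_def
  proof (intro conjI ballI allI)
    show "1 \<in> ?N" using T_1 qmodule_1[OF N] by (auto intro!: bexI[of _ 1])
  next
    fix a b assume "a \<in> ?N" "b \<in> ?N"
    then obtain t u where *: "t \<in> T" "u \<in> T" "t\<^sup>2 * a \<in> N" "u\<^sup>2 * b \<in> N" by blast
    have "u\<^sup>2 * (t\<^sup>2 * a) + t\<^sup>2 * (u\<^sup>2 * b) \<in> N"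
      using * by (simp add: qmodule_add[OF N] qmodule_sq_mult[OF N])
    then have "(t * u)\<^sup>2 * (a + b) \<in> N" by (simp add: power_mult_distrib algebra_simps)
    then show "a + b \<in> ?N" using T_mult * by blast
  next
    fix a s assume "a \<in> ?N"
    then obtain t where "t \<in> T" "t\<^sup>2 * a \<in> N" by blast
    then show "s\<^sup>2 * a \<in> ?N"
      using qmodule_sq_mult[OF N, of "t\<^sup>2 * a" s] by (auto simp: mult_ac)
  qed
  moreover have "N \<subseteq> ?N" using T_1 by (auto intro!: bexI[of _ 1])
  moreover have "- (u\<^sup>2) \<notin> ?N" if u: "u \<in> T" for u
  proof
    assume "- (u\<^sup>2) \<in> ?N"
    then obtain t where "t \<in> T" "t\<^sup>2 * - (u\<^sup>2) \<in> N" by blast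
    then show False using avoid[of "t * u"] T_mult u by (simp add: power_mult_distrib)
  qed
  ultimately have "?N = N" by (rule maximal)
  then show ?thesis using assms by blast
qed

text \<open>Adjoining a missing \<open>a\<close> must produce some \<open>- (t\<^sup>2)\<close>. As
  coefficients of \<open>a\<close> serve all multipliers that map \<open>N\<close> into itself; they
  include the sums of squares, and their closure properties are immediate.\<close>

lemma extend:
  assumes "a \<notin> N"
  obtains t n s where "t \<in> T" "n \<in> N" "\<forall>b\<in>N. s * b \<in> N"
    "n + s * a = - (t\<^sup>2)"
proof -
  define sos where "sos = {s. \<forall>b\<in>N. s * b \<in> N}"
  have s0: "0 \<in> sos" "1 \<in> sos" by (auto simp: sos_def qmodule_0[OF N])
  have sadd: "s + r \<in> sos" if "s \<in> sos" "r \<in> sos" for s r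
    using that by (simp add: sos_def distrib_right qmodule_add[OF N])
  have sq: "r\<^sup>2 * s \<in> sos" if "s \<in> sos" for s r
    using that by (simp add: sos_def mult.assoc qmodule_sq_mult[OF N])
  let ?N = "{n + s * a |n s. n \<in> N \<and> s \<in> sos}"
  have "qmodule ?N" unfolding qmodule_def
  proof (intro conjI ballI allI)
    show "1 \<in> ?N" using qmodule_1[OF N] s0 by force
  next
    fix x y assume "x \<in> ?N" "y \<in> ?N"
    then obtain n s m r where *: "x = n + s * a" "y = m + r * a" "n \<in> N" "m \<in> N" "s \<in> sos" "r \<in> sos"
      by blast
    then have "x + y = (n + m) + (s + r) * a" by (simp add: algebra_simps)
    then show "x + y \<in> ?N" using * qmodule_add[OF N] sadd by blast
  next
    fix x r assume "x \<in> ?N"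
    then obtain n s where *: "x = n + s * a" "n \<in> N" "s \<in> sos" by blast
    then have "r\<^sup>2 * x = r\<^sup>2 * n + (r\<^sup>2 * s) * a" by (simp add: algebra_simps)
    then show "r\<^sup>2 * x \<in> ?N" using * qmodule_sq_mult[OF N] sq by blast
  qed
  moreover have "N \<subseteq> ?N" using s0 by force
  moreover have "a \<in> ?N" using s0 qmodule_0[OF N] by force
  ultimately obtain t where "t \<in> T" "- (t\<^sup>2) \<in> ?N" using maximal assms by blast
  then obtain n s where "n \<in> N" "s \<in> sos" "- (t\<^sup>2) = n + s * a" by blast
  then show ?thesis using that[of t n s] \<open>t \<in> T\<close> by (simp add: sos_def)
qed

lemma total: "a \<in> N \<or> - a \<in> N"
proof (rule ccontr)
  assume "\<not> (a \<in> N \<or> - a \<in> N)"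
  then have "a \<notin> N" "- a \<notin> N" by auto
  obtain t n s where 1: "t \<in> T" "n \<in> N" "\<forall>b\<in>N. s * b \<in> N"
    "n + s * a = - (t\<^sup>2)" using extend[OF \<open>a \<notin> N\<close>] .
  obtain u m r where 2: "u \<in> T" "m \<in> N" "\<forall>b\<in>N. r * b \<in> N"
    "m + r * - a = - (u\<^sup>2)" using extend[OF \<open>- a \<notin> N\<close>] .
  have "r * 1 \<in> N" using 2(3) N qmodule_1 by blast
  \<comment> \<open>The relation for \<open>a\<close> is multiplied by \<open>r\<close>, the one for
    \<open>- a\<close> by \<open>s\<close>; the terms containing \<open>a\<close> cancel.\<close>
  have "r * (n + s * a + t\<^sup>2) + s * (m + r * - a + u\<^sup>2) = 0" using 1(4) 2(4) by simp
  then have "t\<^sup>2 * r + (s * u\<^sup>2 + r * n + s * m) = 0" by (simp add: algebra_simps)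
  then have eq: "- (t\<^sup>2 * r) = s * u\<^sup>2 + r * n + s * m" by (rule minus_unique)
  have "s * u\<^sup>2 + r * n + s * m \<in> N"
    using 1(2,3) 2(2,3) N by (simp add: qmodule_add qmodule_sq)
  then have "t\<^sup>2 * - r \<in> N" using eq by simp
  then have "- r \<in> N" using saturated 1 by blast
  then have "r \<in> supp N" using \<open>r * 1 \<in> N\<close> by (simp add: supp_def)
  then have "a * r \<in> supp N" using supp_mult N by blast
  have "- (u\<^sup>2) = m + - (a * r)" using 2(4) by (simp add: mult.commute)
  also have "\<dots> \<in> N" using \<open>a * r \<in> supp N\<close> 2 N by (intro qmodule_add) (auto simp: supp_def)
  finally show False using avoid 2 by blast
qed

text \<open>If \<open>a\<close> were missing, squaring \<open>s * a = - (t\<^sup>2) - n\<close>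
  would write \<open>- ((t * t)\<^sup>2)\<close> as a sum of
  \<open>- (s\<^sup>2 * a\<^sup>2)\<close>, twice \<open>t\<^sup>2 * n\<close> and
  \<open>n\<^sup>2\<close>, all of them in \<open>N\<close>. The same holds for
  \<open>- a\<close>.\<close>

lemma supp_square:
  assumes "a\<^sup>2 \<in> supp N"
  shows "a \<in> supp N"
proof -
  have *: "a \<in> N" if a: "a\<^sup>2 \<in> supp N" for a
  proof (rule ccontr)
    assume "a \<notin> N"
    obtain t n s where 1: "t \<in> T" "n \<in> N" "n + s * a = - (t\<^sup>2)"
      using extend[OF \<open>a \<notin> N\<close>] .
    have "s * a = - (t\<^sup>2) - n" using 1(3) by (simp add: algebra_simps)
    then have "s\<^sup>2 * a\<^sup>2 = (- (t\<^sup>2) - n)\<^sup>2" by (simp flip: power_mult_distrib)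
    then have "- ((t\<^sup>2)\<^sup>2) = - (s\<^sup>2 * a\<^sup>2) + (t\<^sup>2 * n + t\<^sup>2 * n + n\<^sup>2)"
      by (simp add: power2_eq_square algebra_simps)
    also have "\<dots> \<in> N"
      using supp_mult[OF N a, of "s\<^sup>2"] 1 N
      by (intro qmodule_add qmodule_sq_mult qmodule_sq) (auto simp: supp_def)
    finally show False using avoid[of "t * t"] T_mult 1 by (simp add: power2_eq_square)
  qed
  from *[of a] *[of "- a"] assms show ?thesis by (simp add: supp_def)
qed

text \<open>For \<open>a\<close> outside the support, the elements that \<open>a\<^sup>2\<close>
  multiplies into \<open>N\<close> form another competitor in the maximality condition, hence
  \<open>N\<close> itself. So \<open>a\<^sup>2\<close> can be cancelled from
  \<open>- ((a * b)\<^sup>2)\<close>.\<close>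

lemma supp_prime: "prime_ideal (supp N)"
  unfolding prime_ideal_def
proof (intro conjI ballI allI impI)
  show "1 \<notin> supp N" using avoid[OF T_1] by (simp add: supp_def)
  show "0 \<in> supp N" using qmodule_0[OF N] by (simp add: supp_def)
next
  fix a b assume ab: "a * b \<in> supp N"
  show "a \<in> supp N \<or> b \<in> supp N"
  proof (rule ccontr)
    assume "\<not> ?thesis"
    then have a: "a \<notin> supp N" and b: "b \<notin> supp N" by auto
    let ?N = "{x. a\<^sup>2 * x \<in> N}"
    have "qmodule ?N"
      unfolding qmodule_def
    proof (intro conjI ballI allI)
      fix x s assume "x \<in> ?N"
      then have "s\<^sup>2 * (a\<^sup>2 * x) \<in> N" using qmodule_sq_mult[OF N] by blast
      then show "s\<^sup>2 * x \<in> ?N" by (simp add: mult.left_commute)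
    qed (simp_all add: qmodule_sq[OF N] distrib_left qmodule_add[OF N])
    moreover have "N \<subseteq> ?N" using N by (auto simp: qmodule_sq_mult)
    moreover have "- (t\<^sup>2) \<notin> ?N" if "t \<in> T" for t
    proof
      assume "- (t\<^sup>2) \<in> ?N"
      then have "t\<^sup>2 * - (a\<^sup>2) \<in> N" by (simp add: mult.commute)
      then have "- (a\<^sup>2) \<in> N" using saturated that by blast
      then have "a\<^sup>2 \<in> supp N" using N by (simp add: supp_def qmodule_sq)
      then show False using supp_square a by blast
    qed
    ultimately have eq: "?N = N" by (rule maximal)
    have "- (a * b * (a * b)) \<in> N"
      using supp_mult[OF N ab, of "a * b"] by (simp add: supp_def)
    then have "a\<^sup>2 * - (b\<^sup>2) \<in> N" by (simp add: power2_eq_square mult_ac)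
    then have "- (b\<^sup>2) \<in> N" using eq by blast
    then have "b\<^sup>2 \<in> supp N" using N by (simp add: supp_def qmodule_sq)
    then show False using supp_square b by blast
  qed
qed (use N in \<open>auto intro: supp_add supp_mult\<close>)

lemma supp_avoids: "t \<in> T \<Longrightarrow> t \<notin> supp N"
proof
  assume "t \<in> T" "t \<in> supp N"
  then have "t * t \<in> supp N" using supp_mult N by blast
  then show False using avoid \<open>t \<in> T\<close> by (auto simp: supp_def power2_eq_square)
qed

text \<open>Formal reality of the residue field, in the form needed for quadratic factors: a monic
  real quadratic without real roots is a sum of two squares.\<close>

lemma supp_sum_sq:
  assumes "a\<^sup>2 + b\<^sup>2 \<in> supp N"
  shows "b \<in> supp N"
proof -
  have "- (b\<^sup>2) = a\<^sup>2 + - (a\<^sup>2 + b\<^sup>2)" by simp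
  also have "\<dots> \<in> N" using assms N by (intro qmodule_add qmodule_sq) (auto simp: supp_def)
  finally have "b\<^sup>2 \<in> supp N" using N by (simp add: supp_def qmodule_sq)
  then show ?thesis by (rule supp_square)
qed

end

lemma ex_maximal_qmodule:
  assumes "1 \<in> T" "\<And>t u. t \<in> T \<Longrightarrow> u \<in> T \<Longrightarrow> t * u \<in> T"
    and M: "qmodule M" "\<And>t. t \<in> T \<Longrightarrow> - (t\<^sup>2) \<notin> M"
  obtains N where "M \<subseteq> N" "maximal_qmodule T N"
proof -
  let ?A = "{N. qmodule N \<and> M \<subseteq> N \<and> (\<forall>t\<in>T. - (t\<^sup>2) \<notin> N)}"
  have "\<exists>N\<in>?A. \<forall>X\<in>?A. N \<subseteq> X \<longrightarrow> X = N"
  proof (rule subset_Zorn)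
    fix C assume C: "subset.chain ?A C"
    show "\<exists>U\<in>?A. \<forall>X\<in>C. X \<subseteq> U"
    proof (cases "C = {}")
      \<comment> \<open>The union of the empty chain does not contain 1, so \<open>M\<close> itself
        serves as the bound.\<close>
      case True
      then show ?thesis using M by blast
    next
      case False
      have sub: "X \<in> ?A" if "X \<in> C" for X using C that by (auto simp: subset.chain_def)
      have "qmodule (\<Union>C)" unfolding qmodule_def
      proof (intro conjI ballI allI)
        show "1 \<in> \<Union>C" using False sub qmodule_1 by blast
      next
        fix a b assume "a \<in> \<Union>C" "b \<in> \<Union>C"
        then obtain X Y where XY: "X \<in> C" "Y \<in> C" "a \<in> X" "b \<in> Y" by blast
        have "X \<subseteq> Y \<or> Y \<subseteq> X" using C XY(1,2) unfolding subset_chain_def by blast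
        with XY obtain Z where "Z \<in> C" "a \<in> Z" "b \<in> Z" by auto
        then show "a + b \<in> \<Union>C" using sub qmodule_add by blast
      next
        fix a s assume "a \<in> \<Union>C"
        then show "s\<^sup>2 * a \<in> \<Union>C" using sub qmodule_sq_mult by blast
      qed
      then have "\<Union>C \<in> ?A" using False sub by blast
      then show ?thesis by blast
    qed
  qed
  then obtain N where N: "N \<in> ?A" "\<forall>X\<in>?A. N \<subseteq> X \<longrightarrow> X = N" by (elim bexE)
  have "maximal_qmodule T N"
  proof unfold_locales
    fix N' assume "qmodule N'" "N \<subseteq> N'" "\<And>t. t \<in> T \<Longrightarrow> - (t\<^sup>2) \<notin> N'"
    then have "N' \<in> ?A" using N(1) by blast
    then show "N' = N" using N(2) \<open>N \<subseteq> N'\<close> by blast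
  qed (use N(1) assms(1,2) in auto)
  moreover have "M \<subseteq> N" using N(1) by blast
  ultimately show ?thesis by (intro that)
qed

subsection \<open>Derivations modulo a prime ideal\<close>

text \<open>Stands for the residue domain modulo \<open>P\<close> and its fraction field: "zero"
  means in \<open>P\<close>, and admissible denominators are the elements outside
  \<open>P\<close>.\<close>

locale prime_mod =
  fixes P :: "mpoly set"
  assumes prime: "prime_ideal P"
begin

lemma P_0 [simp]: "0 \<in> P" and P_1 [simp]: "1 \<notin> P"
  and P_add: "a \<in> P \<Longrightarrow> b \<in> P \<Longrightarrow> a + b \<in> P"
  and P_mult: "b \<in> P \<Longrightarrow> a * b \<in> P"
  and P_prime: "a * b \<in> P \<Longrightarrow> a \<in> P \<or> b \<in> P"
  using prime by (auto simp: prime_ideal_def)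

lemma P_mult2: "a \<in> P \<Longrightarrow> a * b \<in> P"
  using P_mult by (simp add: mult.commute)

lemma P_uminus: "a \<in> P \<Longrightarrow> - a \<in> P"
  using P_mult[of a "- 1"] by simp

lemma P_diff: "a \<in> P \<Longrightarrow> b \<in> P \<Longrightarrow> a - b \<in> P"
  using P_add[of a "- b"] P_uminus by simp

lemma P_sum: "(\<And>i. i \<in> F \<Longrightarrow> h i \<in> P) \<Longrightarrow> sum h F \<in> P"
  by (induction F rule: infinite_finite_induct) (auto intro: P_add)

lemma P_cong: "a - b \<in> P \<Longrightarrow> a \<in> P \<longleftrightarrow> b \<in> P"
  using P_add[of "a - b" b] P_diff[of a "a - b"] by auto

lemma Const_notin: "c \<noteq> 0 \<Longrightarrow> Const c \<notin> P"
  using P_mult[of "Const c" "Const (1 / c)"] by (auto simp flip: Const_mult)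

lemma P_poly: "(\<And>i. coeff p i \<in> P) \<Longrightarrow> poly p x \<in> P"
  by (auto simp: poly_altdef intro!: P_sum P_mult2)

text \<open>
  A derivation of a subring with values modulo \<open>P\<close>, encoded as its graph: a subring of the ring of
  dual numbers. Values are only determined modulo \<open>P\<close>, which avoids any choice of representatives.
\<close>

definition derivation :: "(mpoly \<times> mpoly) set \<Rightarrow> bool" where
  "derivation D \<longleftrightarrow> (\<forall>c. (Const c, 0) \<in> D)
     \<and> (\<forall>a a' b b'. (a, a') \<in> D \<longrightarrow> (b, b') \<in> D \<longrightarrow> (a + b, a' + b') \<in> D \<and> (a * b, a * b' + a' * b) \<in> D)
     \<and> (\<forall>a a'. (a, a') \<in> D \<longrightarrow> a \<in> P \<longrightarrow> a' \<in> P)"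

lemma derivation_Const: "derivation D \<Longrightarrow> (Const c, 0) \<in> D"
  and derivation_add: "derivation D \<Longrightarrow> (a, a') \<in> D \<Longrightarrow> (b, b') \<in> D \<Longrightarrow> (a + b, a' + b') \<in> D"
  and derivation_mult: "derivation D \<Longrightarrow> (a, a') \<in> D \<Longrightarrow> (b, b') \<in> D \<Longrightarrow> (a * b, a * b' + a' * b) \<in> D"
  and derivation_in: "derivation D \<Longrightarrow> (a, a') \<in> D \<Longrightarrow> a \<in> P \<Longrightarrow> a' \<in> P"
  unfolding derivation_def by blast+

lemma derivation_Const_mult: "derivation D \<Longrightarrow> (a, a') \<in> D \<Longrightarrow> (Const c * a, Const c * a') \<in> D"
  using derivation_mult[OF _ derivation_Const, of D a a' c] by simp

lemma derivation_diff:
  assumes "derivation D" "(a, a') \<in> D" "(b, b') \<in> D"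
  shows "(a - b, a' - b') \<in> D"
  using derivation_add[OF assms(1,2) derivation_Const_mult[OF assms(1,3), of "- 1"]]
  by (simp add: Const_minus)

lemma derivation_0: "derivation D \<Longrightarrow> (0, 0) \<in> D"
  using derivation_Const[of D 0] by simp

lemma derivation_sum:
  assumes "derivation D" "\<And>i. i \<in> F \<Longrightarrow> (h i, h' i) \<in> D"
  shows "(sum h F, sum h' F) \<in> D"
  using assms(2)
  by (induction F rule: infinite_finite_induct) (auto simp: assms(1) derivation_0 intro!: derivation_add)

lemma derivation_cong:
  assumes "derivation D" "(a, x) \<in> D" "(a, y) \<in> D"
  shows "x - y \<in> P"
  using derivation_in[OF assms(1) derivation_diff[OF assms(1,2,3)]] by simp

text \<open>The second component is the first with the derivation applied to its coefficients. It is
  carried along as a companion because \<open>D\<close> is a relation, not a function.\<close>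

definition dpolys :: "(mpoly \<times> mpoly) set \<Rightarrow> (mpoly poly \<times> mpoly poly) set" where
  "dpolys D = {(p, p'). \<forall>i. (coeff p i, coeff p' i) \<in> D}"

text \<open>The extension of a derivation that gives \<open>u\<close> the value \<open>e / s\<close>
  maps \<open>poly p u\<close> to \<open>poly p' u + (e / s) * poly (pderiv p) u\<close>.
  Multiplication by \<open>s\<close> clears the denominator, so \<open>adjoin\<close> extends
  \<open>s\<close> times the old derivation.\<close>

definition dvalue :: "mpoly \<Rightarrow> mpoly \<Rightarrow> mpoly \<Rightarrow> mpoly poly \<Rightarrow> mpoly poly \<Rightarrow> mpoly" where
  "dvalue u s e p p' = s * poly p' u + e * poly (pderiv p) u"

lemma dvalue_diff: "dvalue u s e (p - q) (p' - q') = dvalue u s e p p' - dvalue u s e q q'"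
  and dvalue_add: "dvalue u s e (p + q) (p' + q') = dvalue u s e p p' + dvalue u s e q q'"
  and dvalue_mult: "dvalue u s e (p * q) (p * q' + p' * q)
    = poly p u * dvalue u s e q q' + dvalue u s e p p' * poly q u"
  by (simp_all add: dvalue_def pderiv_diff pderiv_add pderiv_mult algebra_simps)

lemma dpolys_add:
  "derivation D \<Longrightarrow> (p, p') \<in> dpolys D \<Longrightarrow> (q, q') \<in> dpolys D \<Longrightarrow> (p + q, p' + q') \<in> dpolys D"
  by (auto simp: dpolys_def intro: derivation_add)

lemma dpolys_diff:
  "derivation D \<Longrightarrow> (p, p') \<in> dpolys D \<Longrightarrow> (q, q') \<in> dpolys D \<Longrightarrow> (p - q, p' - q') \<in> dpolys D"
  by (auto simp: dpolys_def intro: derivation_diff)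

lemma dpolys_mult:
  assumes "derivation D" "(p, p') \<in> dpolys D" "(q, q') \<in> dpolys D"
  shows "(p * q, p * q' + p' * q) \<in> dpolys D"
  unfolding dpolys_def
proof (clarify)
  fix i
  have "(\<Sum>j\<le>i. coeff p j * coeff q (i - j), \<Sum>j\<le>i. coeff p j * coeff q' (i - j) + coeff p' j * coeff q (i - j)) \<in> D"
    using assms by (intro derivation_sum derivation_mult) (auto simp: dpolys_def)
  then show "(coeff (p * q) i, coeff (p * q' + p' * q) i) \<in> D"
    by (simp add: coeff_mult sum.distrib)
qed

lemma dpolys_monom: "derivation D \<Longrightarrow> (a, a') \<in> D \<Longrightarrow> (monom a k, monom a' k) \<in> dpolys D"
  by (simp add: dpolys_def derivation_0)

lemma dpolys_pderiv: "derivation D \<Longrightarrow> (p, p') \<in> dpolys D \<Longrightarrow> (pderiv p, pderiv p') \<in> dpolys D"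
  using derivation_Const_mult[of D _ _ "real (Suc _)"]
  by (simp add: dpolys_def coeff_pderiv Const_def single_of_nat[symmetric] del: single_of_nat of_nat_Suc)

definition adjoin :: "mpoly \<Rightarrow> mpoly \<Rightarrow> mpoly \<Rightarrow> (mpoly \<times> mpoly) set \<Rightarrow> (mpoly \<times> mpoly) set" where
  "adjoin u s e D = {(poly p u, dvalue u s e p p') |p p'. (p, p') \<in> dpolys D}"

lemma adjoin_base: "derivation D \<Longrightarrow> (a, a') \<in> D \<Longrightarrow> (a, s * a') \<in> adjoin u s e D"
  unfolding adjoin_def using dpolys_monom[of D a a' 0]
  by (force simp: dvalue_def monom_0)

lemma adjoin_new: "derivation D \<Longrightarrow> (u, e) \<in> adjoin u s e D"
  unfolding adjoin_def using dpolys_monom[OF _ derivation_Const, of D 1 1]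
  by (force simp: dvalue_def poly_monom pderiv_monom)

text \<open>
  The hypothesis provides a divisor for the reduction of \<open>q\<close> with \<open>q(u) \<in> P\<close>, one
  leading term at a time.
\<close>

lemma derivation_adjoin:
  assumes D: "derivation D"
    and divisor: "\<And>q q'. (q, q') \<in> dpolys D \<Longrightarrow> lead_coeff q \<notin> P \<Longrightarrow> poly q u \<in> P \<Longrightarrow>
      \<exists>F F'. (F, F') \<in> dpolys D \<and> degree F \<le> degree q \<and> lead_coeff F \<notin> P \<and> poly F u \<in> P \<and>
        dvalue u s e F F' \<in> P"
  shows "derivation (adjoin u s e D)"
proof -
  \<comment> \<open>Well-definedness: a polynomial expression in \<open>u\<close> that is 0 modulo
    \<open>P\<close> gets a value that is 0 modulo \<open>P\<close>. The induction uses a strict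
    bound \<open>m\<close> on the degree, so that the zero polynomial is the base case.\<close>
  have well: "dvalue u s e q q' \<in> P"
    if "(q, q') \<in> dpolys D" "\<And>i. i \<ge> m \<Longrightarrow> coeff q i = 0" "poly q u \<in> P" for m q q'
    using that
  proof (induction m arbitrary: q q')
    case 0
    then have "q = 0" by (intro poly_eqI) simp
    moreover have "coeff q' i \<in> P" for i
      using 0(1) \<open>q = 0\<close> derivation_in[OF D, of 0] by (auto simp: dpolys_def)
    ultimately show ?case by (simp add: dvalue_def P_mult P_poly)
  next
    case (Suc m)
    define l where "l = coeff q m"
    define l' where "l' = coeff q' m"
    have l: "(l, l') \<in> D" using Suc(2) by (simp add: dpolys_def l_def l'_def)
    show ?case
    proof (cases "l \<in> P")
      \<comment> \<open>A leading coefficient in \<open>P\<close> is dropped; its derivative lies in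
        \<open>P\<close> as well.\<close>
      case True
      then have "l' \<in> P" using derivation_in[OF D l] by blast
      have "dvalue u s e (q - monom l m) (q' - monom l' m) \<in> P"
      proof (rule Suc.IH)
        show "(q - monom l m, q' - monom l' m) \<in> dpolys D"
          using D Suc l by (intro dpolys_diff dpolys_monom)
        show "coeff (q - monom l m) i = 0" if "i \<ge> m" for i
          using Suc(3)[of i] that by (cases "i = m") (auto simp: l_def)
        show "poly (q - monom l m) u \<in> P"
          using True Suc(4) by (auto simp: poly_monom intro!: P_diff P_mult2)
      qed
      moreover have "dvalue u s e (monom l m) (monom l' m) \<in> P"
        unfolding dvalue_def using True \<open>l' \<in> P\<close>
        by (intro P_add P_mult) (simp_all add: pderiv_monom poly_monom P_mult P_mult2)
      ultimately show ?thesis using P_cong dvalue_diff by metis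
    next
      case False
      then have "l \<noteq> 0" by auto
      have deg: "degree q = m"
      proof (rule antisym)
        show "degree q \<le> m" using Suc(3) by (intro degree_le) auto
        show "m \<le> degree q" using \<open>l \<noteq> 0\<close> by (intro le_degree) (simp add: l_def)
      qed
      then obtain F F' where F: "(F, F') \<in> dpolys D" "degree F \<le> m" "lead_coeff F \<notin> P"
        "poly F u \<in> P" "dvalue u s e F F' \<in> P"
        using divisor[OF Suc(2) _ Suc(4)] False by (auto simp: l_def)
      \<comment> \<open>One step of pseudo-division: \<open>A - B\<close> has no coefficient of
        index \<open>m\<close> any more. The companions \<open>A'\<close> and \<open>B'\<close> come
        from the product rule.\<close>
      define k where "k = m - degree F"
      define c where "c = lead_coeff F"
      define c' where "c' = coeff F' (degree F)"
      have c: "(c, c') \<in> D" using F(1) by (simp add: dpolys_def c_def c'_def)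
      define A where "A = monom c 0 * q"
      define A' where "A' = monom c 0 * q' + monom c' 0 * q"
      define B where "B = monom l k * F"
      define B' where "B' = monom l k * F' + monom l' k * F"
      have AD: "(A, A') \<in> dpolys D" and BD: "(B, B') \<in> dpolys D"
        unfolding A_def A'_def B_def B'_def
        by (rule dpolys_mult[OF D dpolys_monom[OF D c] Suc(2)] dpolys_mult[OF D dpolys_monom[OF D l] F(1)])+
      have Bu: "poly B u \<in> P" using F(4) by (simp add: B_def P_mult)
      have "dvalue u s e (A - B) (A' - B') \<in> P"
      proof (rule Suc.IH)
        show "(A - B, A' - B') \<in> dpolys D" using D AD BD by (rule dpolys_diff)
        show "poly (A - B) u \<in> P" using Suc(4) Bu by (auto simp: A_def intro!: P_diff P_mult)
        show "coeff (A - B) i = 0" if "i \<ge> m" for i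
        proof (cases "i = m")
          case True
          then show ?thesis using F(2)
            by (simp add: A_def B_def coeff_monom_mult k_def c_def l_def)
        next
          case False
          then have "coeff F (i - k) = 0" using that F(2) by (intro coeff_eq_0) (auto simp: k_def)
          then show ?thesis using False that Suc(3)[of i]
            by (simp add: A_def B_def coeff_monom_mult k_def)
        qed
      qed
      moreover have "dvalue u s e B B' \<in> P"
        unfolding B_def B'_def dvalue_mult using F by (intro P_add P_mult) auto
      ultimately have "dvalue u s e A A' \<in> P" using P_cong dvalue_diff by metis
      \<comment> \<open>The term with the derivative of \<open>c\<close> carries the factor
        \<open>poly q u\<close>, which is in \<open>P\<close>. Afterwards \<open>c\<close> cancels,
        being outside \<open>P\<close>.\<close>
      then have "c * dvalue u s e q q' + s * c' * poly q u \<in> P"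
        unfolding A_def A'_def dvalue_mult by (simp add: poly_monom dvalue_def pderiv_monom)
      then have "c * dvalue u s e q q' \<in> P"
        using P_diff[of _ "s * c' * poly q u"] P_mult[OF Suc(4)] by fastforce
      then show ?thesis using F(3) P_prime by (auto simp: c_def)
    qed
  qed
  show ?thesis unfolding derivation_def
  proof (intro conjI allI impI)
    fix c
    show "(Const c, 0) \<in> adjoin u s e D"
      using adjoin_base[OF D derivation_Const[OF D], of c s u e] by simp
  next
    fix a a' b b' assume "(a, a') \<in> adjoin u s e D" "(b, b') \<in> adjoin u s e D"
    then obtain p p' q q' where pq: "(p, p') \<in> dpolys D" "(q, q') \<in> dpolys D"
      "a = poly p u" "a' = dvalue u s e p p'" "b = poly q u" "b' = dvalue u s e q q'"
      unfolding adjoin_def by blast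
    show "(a + b, a' + b') \<in> adjoin u s e D"
      unfolding adjoin_def pq(3-) poly_add[symmetric] dvalue_add[symmetric]
      using dpolys_add[OF D pq(1,2)] by blast
    show "(a * b, a * b' + a' * b) \<in> adjoin u s e D"
      unfolding adjoin_def pq(3-) dvalue_mult[symmetric] poly_mult[symmetric]
      using dpolys_mult[OF D pq(1,2)] by blast
  next
    fix a a' assume "(a, a') \<in> adjoin u s e D" "a \<in> P"
    then obtain p p' where p: "(p, p') \<in> dpolys D" "a = poly p u" "a' = dvalue u s e p p'"
      unfolding adjoin_def by blast
    then show "a' \<in> P"
      using well[OF p(1), of "Suc (degree p)"] \<open>a \<in> P\<close> by (simp add: coeff_eq_0)
  qed
qed

text \<open>If \<open>u\<close> is transcendental modulo \<open>P\<close>, its value is free, and 0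
  is taken. Otherwise let \<open>F\<close> be a relation of least degree: differentiating it forces
  the value \<open>- poly F' u / poly (pderiv F) u\<close>, whose denominator is nonzero by
  minimality and characteristic 0.\<close>

lemma ex_derivation_adjoin:
  assumes D: "derivation D"
  obtains s e where "s \<notin> P" "derivation (adjoin u s e D)"
proof (cases "\<exists>q q'. (q, q') \<in> dpolys D \<and> lead_coeff q \<notin> P \<and> poly q u \<in> P")
  case False
  then show ?thesis using derivation_adjoin[OF D, of u 1 0] that[of 1 0] by auto
next
  case True
  define bad where "bad n \<longleftrightarrow> (\<exists>q q'. (q, q') \<in> dpolys D \<and> lead_coeff q \<notin> P \<and> poly q u \<in> P \<and> degree q = n)" for n
  have "\<exists>n. bad n" using True by (auto simp: bad_def)
  then have "bad (LEAST n. bad n)" by (rule LeastI_ex)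
  then obtain F F' where F: "(F, F') \<in> dpolys D" "lead_coeff F \<notin> P" "poly F u \<in> P"
    "degree F = (LEAST n. bad n)" unfolding bad_def by blast
  then have least: "degree F \<le> degree q"
    if "(q, q') \<in> dpolys D" "lead_coeff q \<notin> P" "poly q u \<in> P" for q q'
    using that by (auto intro!: Least_le simp: bad_def)
  have pos: "degree F > 0"
  proof (rule ccontr)
    assume "\<not> degree F > 0"
    then obtain a where "F = [:a:]" using degree_eq_zeroE by blast
    then show False using F by simp
  qed
  \<comment> \<open>Characteristic 0 enters here: the degree is a nonzero real constant, hence
    outside \<open>P\<close>.\<close>
  have "of_nat (degree F) * lead_coeff F \<notin> P"
    using P_prime[of "of_nat (degree F)" "lead_coeff F"] Const_notin[of "real (degree F)"] F(2) pos
    by (auto simp: Const_def)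
  then have lc: "coeff (pderiv F) (degree F - 1) \<notin> P"
    using pos by (simp add: coeff_pderiv)
  have "degree (pderiv F) = degree F - 1"
  proof (rule antisym)
    show "degree (pderiv F) \<le> degree F - 1"
      by (rule degree_le) (auto simp: coeff_pderiv coeff_eq_0)
    show "degree F - 1 \<le> degree (pderiv F)" using lc by (intro le_degree) auto
  qed
  then have s: "poly (pderiv F) u \<notin> P"
    using least[OF dpolys_pderiv[OF D F(1)]] lc pos by auto
  have "dvalue u (poly (pderiv F) u) (- poly F' u) F F' = 0"
    by (simp add: dvalue_def)
  then have "derivation (adjoin u (poly (pderiv F) u) (- poly F' u) D)"
    using F least by (intro derivation_adjoin[OF D]) (metis P_0)
  with s show ?thesis by (rule that)
qed

text \<open>
  Start from \<open>d/df\<close> on \<open>\<real>[f]\<close> and extend it to one variable after the other.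
\<close>

lemma ex_nonvanishing_derivative:
  assumes f: "f \<in> polys N"
    and transc: "\<And>q. q \<noteq> 0 \<Longrightarrow> poly (map_poly Const q) f \<notin> P"
  shows "\<exists>e. (\<forall>p\<in>polys N \<inter> P. (\<Sum>i<N. pdiff i p * e i) \<in> P) \<and> (\<Sum>i<N. pdiff i f * e i) \<notin> P"
proof -
  \<comment> \<open>The zero derivation on the real constants.\<close>
  let ?D0 = "{(Const c, 0) |c. True}"
  have D0: "derivation ?D0"
    unfolding derivation_def using Const_add Const_mult by (auto 0 4 simp flip: Const_add Const_mult)
  have "derivation (adjoin f 1 1 ?D0)"
  proof (rule derivation_adjoin[OF D0])
    \<comment> \<open>This situation cannot occur: the coefficients of \<open>q\<close> are real
      constants, recovered as coefficients of the monomial 0, so \<open>poly q f\<close> in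
      \<open>P\<close> contradicts \<open>transc\<close>.\<close>
    fix q q' assume q: "(q, q') \<in> dpolys ?D0" "lead_coeff q \<notin> P" "poly q f \<in> P"
    define r where "r = map_poly (\<lambda>x. Poly_Mapping.lookup x 0) q"
    have "\<exists>c. coeff q i = Const c" for i using q(1) by (auto simp: dpolys_def)
    then have "Const (Poly_Mapping.lookup (coeff q i) 0) = coeff q i" for i
      by (metis Const_def lookup_single_eq)
    then have "map_poly Const r = q"
      by (intro poly_eqI) (simp add: r_def coeff_map_poly)
    moreover have "r \<noteq> 0" using calculation q(2) by auto
    ultimately show "\<exists>F F'. (F, F') \<in> dpolys ?D0 \<and> degree F \<le> degree q \<and> lead_coeff F \<notin> P \<and> poly F f \<in> P \<and>
        dvalue f 1 1 F F' \<in> P" using transc q(3) by blast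
  qed
  then have base: "\<exists>D w. derivation D \<and> (f, w) \<in> D \<and> w \<notin> P"
    using adjoin_new[OF D0] P_1 by blast
  \<comment> \<open>Each new variable rescales the derivation by some \<open>s\<close> outside
    \<open>P\<close>. The value at \<open>f\<close> becomes \<open>s * w\<close>, still outside
    \<open>P\<close>; hence \<open>w\<close> and \<open>e\<close> change together with
    \<open>D\<close>.\<close>
  have "\<exists>D w e. derivation D \<and> (f, w) \<in> D \<and> w \<notin> P \<and> (\<forall>i<k. (Var i, e i) \<in> D)" for k
  proof (induction k)
    case 0
    then show ?case using base by auto
  next
    case (Suc k)
    then obtain D w e where D: "derivation D" "(f, w) \<in> D" "w \<notin> P" "\<forall>i<k. (Var i, e i) \<in> D" by blast
    obtain s y where s: "s \<notin> P" "derivation (adjoin (Var k) s y D)"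
      using ex_derivation_adjoin[OF D(1)] .
    have "(Var i, (if i = k then y else s * e i)) \<in> adjoin (Var k) s y D" if "i < Suc k" for i
      using adjoin_new[OF D(1)] adjoin_base[OF D(1)] D(4) that by (auto simp: less_Suc_eq)
    moreover have "s * w \<notin> P" using s(1) D(3) P_prime by blast
    ultimately show ?case
      using s(2) adjoin_base[OF D(1,2)] by (intro exI[of _ "adjoin (Var k) s y D"] exI[of _ "s * w"]
          exI[of _ "\<lambda>i. if i = k then y else s * e i"]) auto
  qed
  then obtain D w e where D: "derivation D" "(f, w) \<in> D" "w \<notin> P" "\<forall>i<N. (Var i, e i) \<in> D" by metis
  \<comment> \<open>Chain rule: the graph contains, for each polynomial, the value computed from
    partial derivatives. Uniqueness modulo \<open>P\<close> then compares it with
    \<open>w\<close>.\<close>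
  have chain: "(p, \<Sum>i<N. pdiff i p * e i) \<in> D" if "p \<in> polys N" for p
    using that
  proof (induction rule: polys_induct)
    case (Const c)
    then show ?case using derivation_Const[OF D(1)] by simp
  next
    case (Var i)
    then have "(\<Sum>j<N. pdiff j (Var i) * e j) = (\<Sum>j<N. if j = i then e j else 0)"
      by (intro sum.cong) (auto simp: pdiff_Var)
    then show ?case using Var D(4) by simp
  next
    case (add p q)
    then show ?case using derivation_add[OF D(1) add]
      by (simp add: pdiff_add distrib_right sum.distrib)
  next
    case (mult p q)
    have "(\<Sum>i<N. pdiff i (p * q) * e i) = p * (\<Sum>i<N. pdiff i q * e i) + (\<Sum>i<N. pdiff i p * e i) * q"
      by (simp add: pdiff_mult distrib_right sum.distrib sum_distrib_left sum_distrib_right distrib_left mult_ac add.commute)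
    then show ?case using derivation_mult[OF D(1) mult] by simp
  qed
  have "(\<Sum>i<N. pdiff i f * e i) \<notin> P"
    using derivation_cong[OF D(1,2) chain[OF f]] D(3) P_cong by blast
  moreover have "(\<Sum>i<N. pdiff i p * e i) \<in> P" if "p \<in> polys N \<inter> P" for p
    using derivation_in[OF D(1) chain] that by blast
  ultimately show ?thesis by blast
qed

end

subsection \<open>Real points of archimedean quadratic modules\<close>

lemma poly_Const_add:
  "poly (map_poly Const (p + q)) f = poly (map_poly Const p) f + poly (map_poly Const q) f"
proof -
  have "map_poly Const (p + q) = map_poly Const p + map_poly Const q"
    by (intro poly_eqI) (simp add: coeff_map_poly Const_add)
  then show ?thesis by simp
qed

lemma poly_Const_mult:
  "poly (map_poly Const (p * q)) f = poly (map_poly Const p) f * poly (map_poly Const q) f"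
  by (induction p)
    (simp_all add: map_poly_pCons map_poly_smult Const_mult poly_Const_add algebra_simps)

lemma poly_Const_power: "poly (map_poly Const (p ^ k)) f = poly (map_poly Const p) f ^ k"
  by (induction k) (simp_all add: poly_Const_mult map_poly_1)

lemma poly_Const_polys: "f \<in> polys N \<Longrightarrow> poly (map_poly Const p) f \<in> polys N"
  by (induction p) (simp_all add: map_poly_pCons)

lemma poly_map_of_real: "poly (map_poly complex_of_real p) (complex_of_real x) = complex_of_real (poly p x)"
  by (induction p) (simp_all add: map_poly_pCons)

text \<open>A complex root of \<open>q\<close> splits off a real factor of degree 1 or 2, and
  \<open>P\<close> contains the value at \<open>f\<close> of this factor or of its cofactor of
  smaller degree. A quadratic factor is excluded: its value is a sum of two squares, one of them
  that of the nonzero constant \<open>Im w\<close>.\<close>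

lemma real_prime_root:
  assumes P: "prime_ideal P" and real: "\<And>a b. a\<^sup>2 + b\<^sup>2 \<in> P \<Longrightarrow> b \<in> P"
    and "q \<noteq> 0" "poly (map_poly Const q) f \<in> P"
  shows "\<exists>c. f - Const c \<in> P"
  using assms(3,4)
proof (induction "degree q" arbitrary: q rule: less_induct)
  case less
  have notin: "Const c \<notin> P" if "c \<noteq> 0" for c
  proof
    assume "Const c \<in> P"
    then have "Const (1 / c) * Const c \<in> P" using P by (simp add: prime_ideal_def)
    then show False using that P by (simp add: prime_ideal_def flip: Const_mult)
  qed
  let ?q = "map_poly complex_of_real q"
  have deg: "degree ?q = degree q" by (rule degree_map_poly) simp
  have "degree q \<noteq> 0"
  proof
    assume "degree q = 0"
    then obtain a where "q = [:a:]" by (elim degree_eq_zeroE)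
    then show False using less.prems notin by (simp add: map_poly_pCons)
  qed
  then have "\<not> constant (poly ?q)" using deg by (simp add: constant_degree)
  then obtain w where w: "poly ?q w = 0" using fundamental_theorem_of_algebra by blast
  have split: "\<exists>c. f - Const c \<in> P"
    if m: "q = m * q1" "degree m > 0" and "poly (map_poly Const m) f \<in> P \<Longrightarrow> \<exists>c. f - Const c \<in> P" for m q1
  proof -
    have "q1 \<noteq> 0" "m \<noteq> 0" using m less.prems by auto
    then have "degree q1 < degree q" using m by (simp add: degree_mult_eq)
    moreover have "poly (map_poly Const m) f \<in> P \<or> poly (map_poly Const q1) f \<in> P"
      using less.prems(2) P m unfolding prime_ideal_def by (simp add: poly_Const_mult)
    ultimately show ?thesis using that less.hyps \<open>q1 \<noteq> 0\<close> by blast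
  qed
  show ?case
  proof (cases "Im w = 0")
    case True
    then have "w = complex_of_real (Re w)" by (simp add: complex_eq_iff)
    then have "complex_of_real (poly q (Re w)) = 0" using w by (metis poly_map_of_real)
    then have "[:- Re w, 1:] dvd q" by (simp add: poly_eq_0_iff_dvd)
    then obtain q1 where "q = [:- Re w, 1:] * q1" by (elim dvdE)
    then show ?thesis
      by (rule split) (auto simp: map_poly_pCons Const_minus intro!: exI[of _ "Re w"])
  next
    case False
    let ?m = "[:(Re w)\<^sup>2 + (Im w)\<^sup>2, - 2 * Re w, 1:]"
    let ?c = "map_poly complex_of_real"
    define r where "r = q mod ?m"
    have mult: "?c (a * b) = ?c a * ?c b" "?c (a + b) = ?c a + ?c b" for a b
      by (intro poly_eqI; simp add: coeff_map_poly coeff_mult)+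
    have m0: "poly (?c ?m) w = 0"
      by (simp add: map_poly_pCons complex_eq_iff power2_eq_square algebra_simps)
    have qr: "q = ?m * (q div ?m) + r" unfolding r_def by (rule mult_div_mod_eq[symmetric])
    then have "poly (?c r) w = 0"
      using w m0 qr by (metis mult add_0 mult_zero_left poly_add poly_mult)
    moreover have "degree r < 2"
      using degree_mod_less[of ?m q] by (auto simp: r_def)
    then have "coeff r i = 0" if "i \<ge> 2" for i using that by (simp add: coeff_eq_0)
    then have r: "r = [:coeff r 0, coeff r 1:]"
      by (intro poly_eqI) (auto simp: coeff_pCons split: nat.splits)
    ultimately have "complex_of_real (coeff r 0) + w * complex_of_real (coeff r 1) = 0"
      by (metis (no_types, lifting) map_poly_pCons map_poly_0 poly_pCons poly_0 mult_zero_right add_0_right of_real_0)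
    \<comment> \<open>A real affine polynomial that vanishes at the nonreal \<open>w\<close> is
      0.\<close>
    then have "coeff r 1 = 0" "coeff r 0 = 0" using False by (auto simp: complex_eq_iff)
    then have "r = 0" using r by simp
    then have "q = ?m * (q div ?m)" using qr by simp
    then show ?thesis
    proof (rule split)
      assume "poly (map_poly Const ?m) f \<in> P"
      moreover have "poly (map_poly Const ?m) f = (f - Const (Re w))\<^sup>2 + (Const (Im w))\<^sup>2"
        by (simp add: map_poly_pCons Const_add Const_mult Const_minus Const_numeral power2_eq_square algebra_simps)
      ultimately have "Const (Im w) \<in> P" using real by metis
      then show ?thesis using notin False by blast
    qed simp
  qed
qed

definition bounded_in :: "mpoly set \<Rightarrow> mpoly \<Rightarrow> bool" where
  "bounded_in M a \<longleftrightarrow> (\<exists>r. Const r - a \<in> M \<and> Const r + a \<in> M)"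

text \<open>The product of \<open>Const d - a\<close> and \<open>Const d + a\<close> need not be
  directly available, but each factor times the square of the other is. The sum of the two is
  \<open>2 * d\<close> times the product.\<close>

lemma qmodule_sq_diff:
  assumes M: "qmodule M" and "d > 0" "Const d - a \<in> M" "Const d + a \<in> M"
  shows "Const (d\<^sup>2) - a\<^sup>2 \<in> M"
proof -
  let ?s = "(Const d + a)\<^sup>2 * (Const d - a) + (Const d - a)\<^sup>2 * (Const d + a)"
  have "?s \<in> M" using assms by (simp add: qmodule_add qmodule_sq_mult)
  then have "Const (1 / (2 * d)) * ?s \<in> M" using M \<open>d > 0\<close> by (simp add: qmodule_Const_mult)
  moreover have "?s = Const (2 * d) * (Const (d\<^sup>2) - a\<^sup>2)"
    by (simp add: Const_mult Const_numeral Const_power power2_eq_square algebra_simps)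
  then have "Const (1 / (2 * d)) * ?s = Const (1 / (2 * d) * (2 * d)) * (Const (d\<^sup>2) - a\<^sup>2)"
    by (simp only: Const_mult mult.assoc)
  ultimately show ?thesis using \<open>d > 0\<close> by simp
qed

lemma bounded_in_add:
  assumes "qmodule M" "bounded_in M a" "bounded_in M b"
  shows "bounded_in M (a + b)"
proof -
  obtain r s where *: "Const r - a \<in> M" "Const r + a \<in> M" "Const s - b \<in> M" "Const s + b \<in> M"
    using assms by (auto simp: bounded_in_def)
  have "Const (r + s) - (a + b) \<in> M" "Const (r + s) + (a + b) \<in> M"
    using qmodule_add[OF assms(1) *(1,3)] qmodule_add[OF assms(1) *(2,4)]
    by (simp_all add: Const_add algebra_simps)
  then show ?thesis by (auto simp: bounded_in_def)
qed

lemma bounded_in_uminus: "bounded_in M a \<Longrightarrow> bounded_in M (- a)"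
  by (auto simp: bounded_in_def)

lemma bounded_in_Const_mult:
  assumes "qmodule M" "bounded_in M a"
  shows "bounded_in M (Const c * a)"
proof -
  have pos: "bounded_in M (Const c * a)" if "c \<ge> 0" for c
  proof -
    obtain r where "Const r - a \<in> M" "Const r + a \<in> M" using assms by (auto simp: bounded_in_def)
    then have "Const c * (Const r - a) \<in> M" "Const c * (Const r + a) \<in> M"
      using assms that by (simp_all add: qmodule_Const_mult)
    then show ?thesis by (auto simp: bounded_in_def Const_mult algebra_simps intro!: exI[of _ "c * r"])
  qed
  show ?thesis using pos[of c] bounded_in_uminus[OF pos[of "- c"]] by (cases "c \<ge> 0") (auto simp: Const_minus)
qed

lemma bounded_in_square:
  assumes M: "qmodule M" and "bounded_in M a"
  shows "bounded_in M (a\<^sup>2)"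
proof -
  obtain r where r: "Const r - a \<in> M" "Const r + a \<in> M" using assms by (auto simp: bounded_in_def)
  \<comment> \<open>The bound \<open>r\<close> may fail to be positive, while
    \<open>qmodule_sq_diff\<close> divides by the bound; adding \<open>\<bar>r\<bar> + 1\<close>
    makes it at least 1.\<close>
  define d where "d = r + (\<bar>r\<bar> + 1)"
  have "Const (\<bar>r\<bar> + 1) \<in> M" using M by (simp add: qmodule_Const)
  then have "(Const r - a) + Const (\<bar>r\<bar> + 1) \<in> M" "(Const r + a) + Const (\<bar>r\<bar> + 1) \<in> M"
    using r by (auto intro: qmodule_add[OF M])
  then have "Const d - a \<in> M" "Const d + a \<in> M"
    unfolding d_def Const_add[of r] by (simp_all add: algebra_simps)
  then have "Const (d\<^sup>2) - a\<^sup>2 \<in> M" using M by (intro qmodule_sq_diff) (auto simp: d_def)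
  moreover have "Const (d\<^sup>2) + a\<^sup>2 \<in> M" using M by (intro qmodule_add qmodule_Const qmodule_sq) simp_all
  ultimately show ?thesis by (auto simp: bounded_in_def)
qed

text \<open>Polarisation: it reduces boundedness of products, and later their values, to the case of
  squares.\<close>

lemma mult_eq_squares: "(a::mpoly) * b = Const (1/4) * ((a + b)\<^sup>2 + - ((a - b)\<^sup>2))"
proof -
  have "Const (1/4) * ((a + b)\<^sup>2 + - ((a - b)\<^sup>2)) = Const (1/4) * Const 4 * (a * b)"
    by (simp add: power2_eq_square algebra_simps Const_numeral)
  then show ?thesis by (simp flip: Const_mult)
qed

lemma bounded_in_all:
  assumes M: "qmodule M" and V: "\<And>i. \<exists>r. Const r - (Var i)\<^sup>2 \<in> M"
  shows "bounded_in M a"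
proof (induction a rule: mpoly_induct)
  case (Const c)
  have "Const (\<bar>c\<bar> - c) \<in> M" "Const (\<bar>c\<bar> + c) \<in> M" using M by (auto intro!: qmodule_Const)
  then show ?case by (auto simp: bounded_in_def Const_add Const_diff)
next
  case (Var i)
  obtain r where r: "Const r - (Var i)\<^sup>2 \<in> M" using V by blast
  \<comment> \<open>For \<open>s\<close> equal to 1 or -1 the square of the variable cancels, and a
    bound \<open>(1 + r) / 2\<close> on plus or minus the variable remains.\<close>
  have "Const (1/2) * ((1 + s * Var i)\<^sup>2 + (Const r - (Var i)\<^sup>2)) \<in> M" for s
    using M r by (intro qmodule_Const_mult qmodule_add qmodule_sq) simp_all
  from this[of "- 1"] this[of 1]
  have *: "Const (1/2) * (Const (1 + r) + Const (- 2) * Var i) \<in> M"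
     "Const (1/2) * (Const (1 + r) + Const 2 * Var i) \<in> M"
    by (simp_all add: power2_eq_square algebra_simps Const_add Const_minus Const_numeral)
  have "Const ((1 + r) / 2) + Const (- 1) * Var i \<in> M" "Const ((1 + r) / 2) + Const 1 * Var i \<in> M"
    using * unfolding distrib_left mult.assoc[symmetric] Const_mult[symmetric] by (simp_all add: add_divide_distrib)
  then show ?case by (auto simp: bounded_in_def Const_minus)
next
  case (add p q)
  then show ?case by (rule bounded_in_add[OF M])
next
  case (mult p q)
  then show ?case
    unfolding mult_eq_squares[of p q] diff_conv_add_uminus
    by (intro bounded_in_Const_mult bounded_in_add bounded_in_uminus bounded_in_square M)
qed

section \<open>From a total archimedean module to a real point\<close>

locale total_archimedean =
  fixes N :: "mpoly set"
  assumes N: "qmodule N" and total: "a \<in> N \<or> - a \<in> N" and arch: "bounded_in N a" and proper: "- 1 \<notin> N"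
begin

text \<open>\<open>x\<close> is the standard part of \<open>a\<close> with respect to
  \<open>N\<close>: their difference is infinitesimal. The slack \<open>\<epsilon>\<close> makes the
  relation stable under limits, which membership in \<open>N\<close> need not be.\<close>

definition has_value :: "mpoly \<Rightarrow> real \<Rightarrow> bool" where
  "has_value a x \<longleftrightarrow> (\<forall>\<epsilon>>0. Const (x + \<epsilon>) - a \<in> N \<and> a - Const (x - \<epsilon>) \<in> N)"

lemma Const_in_iff: "Const c \<in> N \<longleftrightarrow> c \<ge> 0"
proof
  assume c: "Const c \<in> N"
  show "c \<ge> 0"
  proof (rule ccontr)
    assume "\<not> c \<ge> 0"
    then have "Const (- (1 / c)) * Const c \<in> N" using N c by (intro qmodule_Const_mult) simp_all
    then show False using \<open>\<not> c \<ge> 0\<close> proper by (simp add: Const_minus flip: Const_mult)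
  qed
qed (use N in \<open>auto intro: qmodule_Const\<close>)

text \<open>A Dedekind cut: the constants below \<open>a\<close> are nonempty and bounded by the
  archimedean property, and totality puts \<open>a\<close> below every constant that exceeds their
  supremum.\<close>

lemma ex_value: "\<exists>x. has_value a x"
proof -
  let ?A = "{r. a - Const r \<in> N}"
  obtain r where r: "Const r - a \<in> N" "Const r + a \<in> N" using arch by (auto simp: bounded_in_def)
  have up: "s \<le> r" if "s \<in> ?A" for s
    using qmodule_add[OF N, of "a - Const s" "Const r - a"] that r Const_in_iff[of "r - s"]
    by (simp add: Const_diff)
  have ne: "- r \<in> ?A" using r by (simp add: Const_minus add.commute)
  have bdd: "bdd_above ?A" using up by (auto simp: bdd_above_def)
  have "has_value a (Sup ?A)" unfolding has_value_def
  proof (intro allI impI conjI)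
    fix e :: real assume "e > 0"
    have "Sup ?A + e \<notin> ?A" using cSup_upper[OF _ bdd, of "Sup ?A + e"] \<open>e > 0\<close> by auto
    then show "Const (Sup ?A + e) - a \<in> N" using total[of "a - Const (Sup ?A + e)"] by simp
    obtain s where s: "s \<in> ?A" "Sup ?A - e < s"
      using less_cSup_iff[of ?A "Sup ?A - e"] ne bdd \<open>e > 0\<close> by auto
    have "(a - Const s) + Const (s - (Sup ?A - e)) \<in> N"
      using s N by (intro qmodule_add qmodule_Const) auto
    moreover have "(a - Const s) + Const (s - t) = a - Const t" for t by (simp add: Const_diff)
    ultimately show "a - Const (Sup ?A - e) \<in> N" by simp
  qed
  then show ?thesis by blast
qed

lemma has_value_Const: "has_value (Const c) c"
  by (auto simp: has_value_def Const_in_iff simp flip: Const_diff)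

lemma has_value_add:
  assumes "has_value a x" "has_value b y"
  shows "has_value (a + b) (x + y)"
  unfolding has_value_def
proof (intro allI impI conjI)
  fix e :: real assume "e > 0"
  then have h: "Const (x + e/2) - a \<in> N" "a - Const (x - e/2) \<in> N"
    "Const (y + e/2) - b \<in> N" "b - Const (y - e/2) \<in> N"
    using assms unfolding has_value_def by (meson half_gt_zero)+
  have c: "Const (x + e/2) + Const (y + e/2) = Const (x + y + e)"
    "Const (x - e/2) + Const (y - e/2) = Const (x + y - e)"
    by (simp_all flip: Const_add) (simp_all add: algebra_simps)
  show "Const (x + y + e) - (a + b) \<in> N"
    using qmodule_add[OF N h(1,3)] unfolding c(1)[symmetric] add_diff_add .
  show "a + b - Const (x + y - e) \<in> N"
    using qmodule_add[OF N h(2,4)] unfolding c(2)[symmetric] add_diff_add .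
qed

lemma has_value_uminus: "has_value a x \<Longrightarrow> has_value (- a) (- x)"
  unfolding has_value_def
proof (intro allI impI)
  fix e :: real assume a: "\<forall>\<epsilon>>0. Const (x + \<epsilon>) - a \<in> N \<and> a - Const (x - \<epsilon>) \<in> N" and "e > 0"
  have eq: "Const (- x + e) - - a = a - Const (x - e)" "- a - Const (- x - e) = Const (x + e) - a"
    by (simp_all add: Const_add Const_diff Const_minus)
  show "Const (- x + e) - - a \<in> N \<and> - a - Const (- x - e) \<in> N"
    unfolding eq using a \<open>e > 0\<close> by blast
qed

lemma has_value_Const_mult:
  assumes "has_value a x"
  shows "has_value (Const c * a) (c * x)"
proof -
  have pos: "has_value (Const c * a) (c * x)" if "c > 0" "has_value a x" for c a x
    unfolding has_value_def
  proof (intro allI impI)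
    fix e :: real assume "e > 0"
    then have "Const c * (Const (x + e / c) - a) \<in> N" "Const c * (a - Const (x - e / c)) \<in> N"
      using that(2)[unfolded has_value_def, rule_format, of "e / c"] that(1) N
      by (simp_all add: qmodule_Const_mult)
    moreover have "c * (x + e / c) = c * x + e" "c * (x - e / c) = c * x - e"
      using that by (simp_all add: field_simps)
    ultimately show "Const (c * x + e) - Const c * a \<in> N \<and> Const c * a - Const (c * x - e) \<in> N"
      unfolding right_diff_distrib Const_mult[symmetric] by simp
  qed
  consider "c = 0" | "c > 0" | "- c > 0" by linarith
  then show ?thesis
  proof cases
    case 1
    then show ?thesis using has_value_Const[of 0] by simp
  next
    case 2
    then show ?thesis using assms by (rule pos)
  next
    case 3
    from pos[OF this has_value_uminus[OF assms]] show ?thesis by (simp add: Const_minus)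
  qed
qed

lemma has_value_square_0:
  assumes "has_value a 0"
  shows "has_value (a\<^sup>2) 0"
  unfolding has_value_def
proof (intro allI impI conjI)
  fix e :: real assume "e > 0"
  then have "Const (sqrt e) - a \<in> N" "Const (sqrt e) + a \<in> N"
    using assms[unfolded has_value_def, rule_format, of "sqrt e"] by (auto simp: Const_minus add.commute)
  then have "Const ((sqrt e)\<^sup>2) - a\<^sup>2 \<in> N" using N \<open>e > 0\<close> by (intro qmodule_sq_diff) simp_all
  then show "Const (0 + e) - a\<^sup>2 \<in> N" using \<open>e > 0\<close> by simp
  have "a\<^sup>2 + Const e \<in> N" using N \<open>e > 0\<close> by (simp add: qmodule_add qmodule_sq qmodule_Const)
  then show "a\<^sup>2 - Const (0 - e) \<in> N" by (simp add: Const_minus)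
qed

text \<open>Both factors are shifted to value 0; polarisation reduces the product of these
  infinitesimals to squares, and the shift is then expanded.\<close>

lemma has_value_mult:
  assumes "has_value a x" "has_value b y"
  shows "has_value (a * b) (x * y)"
proof -
  define a0 where "a0 = a + Const (- x)"
  define b0 where "b0 = b + Const (- y)"
  have 0: "has_value a0 0" "has_value b0 0"
    using has_value_add[OF assms(1) has_value_Const[of "- x"]] has_value_add[OF assms(2) has_value_Const[of "- y"]]
    by (simp_all add: a0_def b0_def)
  have "has_value ((a0 + b0)\<^sup>2) 0" "has_value ((a0 + Const (- 1) * b0)\<^sup>2) 0"
    using has_value_square_0[OF has_value_add[OF 0, simplified]]
      has_value_square_0[OF has_value_add[OF 0(1) has_value_Const_mult[OF 0(2), of "- 1"], simplified]]
    by auto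
  from has_value_Const_mult[OF has_value_add[OF this(1) has_value_Const_mult[OF this(2), of "- 1"]], of "1/4"]
  have ab0: "has_value (a0 * b0) 0"
    unfolding mult_eq_squares[of a0 b0] by (simp add: Const_minus)
  from has_value_add[OF has_value_add[OF has_value_add[OF ab0 has_value_Const_mult[OF assms(1), of y]]
      has_value_Const_mult[OF assms(2), of x]] has_value_Const[of "- (x * y)"]]
  have "has_value (a0 * b0 + Const y * a + Const x * b + Const (- (x * y))) (x * y)"
    by (simp add: algebra_simps)
  moreover have "a0 * b0 + Const y * a + Const x * b + Const (- (x * y)) = a * b"
    by (simp add: a0_def b0_def algebra_simps Const_minus Const_mult)
  ultimately show ?thesis by simp
qed

lemma ex_point: "\<exists>y. \<forall>p\<in>N. eval y p \<ge> 0"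
proof -
  define y where "y i = (SOME x. has_value (Var i) x)" for i
  have y: "has_value (Var i) (y i)" for i unfolding y_def by (rule someI_ex) (rule ex_value)
  have val: "has_value p (eval y p)" for p
    by (induction p rule: mpoly_induct)
      (simp_all add: eval_simps y has_value_Const has_value_add has_value_mult)
  have "eval y p \<ge> 0" if "p \<in> N" for p
  proof (rule ccontr)
    assume neg: "\<not> eval y p \<ge> 0"
    \<comment> \<open>The slack is half the absolute value of the negative number
      \<open>eval y p\<close>. Adding \<open>p\<close> leaves a negative constant in
      \<open>N\<close>.\<close>
    then have "Const (eval y p + - eval y p / 2) - p \<in> N" using val[of p] unfolding has_value_def
      by (meson divide_pos_pos neg_0_less_iff_less not_le zero_less_numeral)
    from qmodule_add[OF N this \<open>p \<in> N\<close>] show False using neg by (simp add: Const_in_iff)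
  qed
  then show ?thesis by blast
qed

end

subsection \<open>The critical ideal\<close>

lemma h_FJ_mem:
  "i < n \<Longrightarrow> Lam n 0 * pdiff i f - (\<Sum>j<length g. Lam n (j + 1) * pdiff i (g ! j)) \<in> set (h_FJ n f g)"
  "j < length g \<Longrightarrow> Lam n (j + 1) * g ! j \<in> set (h_FJ n f g)"
  "1 - (\<Sum>j\<le>length g. (Lam n j)\<^sup>2) \<in> set (h_FJ n f g)"
  by (auto simp: h_FJ_def)

lemma Lam_polys: "j \<le> length g \<Longrightarrow> Lam n j \<in> polys (nz n g)"
  by (simp add: Lam_def nz_def)

lemma h_FJ_polys:
  assumes "f \<in> polys n" "set g \<subseteq> polys n" "p \<in> set (h_FJ n f g)"
  shows "p \<in> polys (nz n g)"
proof -
  have *: "q \<in> polys (nz n g)" if "q \<in> polys n" for q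
    using polys_mono[of n "nz n g" q] that by (simp add: nz_def)
  have g: "g ! j \<in> polys n" if "j < length g" for j using assms(2) that by auto
  have "pdiff i f \<in> polys (nz n g)" for i using pdiff_polys[OF assms(1)] by (rule *)
  moreover have "g ! j \<in> polys (nz n g)" "pdiff i (g ! j) \<in> polys (nz n g)" if "j < length g" for i j
    using g[OF that] pdiff_polys[OF g[OF that]] by (auto intro: *)
  ultimately show ?thesis using assms(3) unfolding h_FJ_def
    by (auto intro!: polys_diff polys_mult polys_sum polys_power Lam_polys)
qed

lemma critical_value:
  assumes P: "prime_ideal P" and real: "\<And>a b. a\<^sup>2 + b\<^sup>2 \<in> P \<Longrightarrow> b \<in> P"
    and h: "set (h_FJ n f g) \<subseteq> P" and Lam0: "Lam n 0 \<notin> P"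
    and f: "f \<in> polys n" and g: "set g \<subseteq> polys n"
  shows "\<exists>c. f - Const c \<in> P"
proof (rule ccontr)
  assume no: "\<not> ?thesis"
  interpret prime_mod P using P by unfold_locales
  have "poly (map_poly Const q) f \<notin> P" if "q \<noteq> 0" for q
  proof
    assume "poly (map_poly Const q) f \<in> P"
    then have "\<exists>c. f - Const c \<in> P"
      by (rule real_prime_root[OF P _ that, rotated]) (rule real)
    with no show False by blast
  qed
  then obtain e where e: "\<And>p. p \<in> polys n \<inter> P \<Longrightarrow> (\<Sum>i<n. pdiff i p * e i) \<in> P"
    "(\<Sum>i<n. pdiff i f * e i) \<notin> P"
    using ex_nonvanishing_derivative[OF f] by blast
  have grad: "Lam n 0 * pdiff i f - (\<Sum>j<length g. Lam n (j + 1) * pdiff i (g ! j)) \<in> P" if "i < n" for i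
    using h h_FJ_mem(1)[OF that] by blast
  \<comment> \<open>Contracting the gradient relations with \<open>e\<close> turns gradients into
    values of the derivation. A constraint in \<open>P\<close> has derivative in \<open>P\<close>;
    for any other constraint the multiplier is in \<open>P\<close>.\<close>
  have "(\<Sum>i<n. e i * (Lam n 0 * pdiff i f - (\<Sum>j<length g. Lam n (j + 1) * pdiff i (g ! j)))) \<in> P"
    using grad by (intro P_sum P_mult) simp
  moreover have "(\<Sum>i<n. e i * (Lam n 0 * pdiff i f - (\<Sum>j<length g. Lam n (j + 1) * pdiff i (g ! j))))
    = Lam n 0 * (\<Sum>i<n. pdiff i f * e i) - (\<Sum>i<n. \<Sum>j<length g. Lam n (j + 1) * (pdiff i (g ! j) * e i))"
    by (simp add: right_diff_distrib sum_subtractf sum_distrib_left mult_ac)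
  moreover have "(\<Sum>i<n. \<Sum>j<length g. Lam n (j + 1) * (pdiff i (g ! j) * e i)) \<in> P"
  proof (subst sum.swap, rule P_sum)
    fix j assume j: "j \<in> {..<length g}"
    have "Lam n (j + 1) * g ! j \<in> P" using h h_FJ_mem(2) j by blast
    then have "Lam n (j + 1) \<in> P \<or> g ! j \<in> P" by (rule P_prime)
    moreover have "(\<Sum>i<n. pdiff i (g ! j) * e i) \<in> P" if "g ! j \<in> P"
    proof -
      have "g ! j \<in> polys n" by (rule subsetD[OF g nth_mem]) (use j in simp)
      then show ?thesis by (rule e(1)[OF IntI[OF _ that]])
    qed
    ultimately show "(\<Sum>i<n. Lam n (j + 1) * (pdiff i (g ! j) * e i)) \<in> P"
      unfolding sum_distrib_left[symmetric] by (auto intro: P_mult P_mult2)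
  qed
  ultimately have "Lam n 0 * (\<Sum>i<n. pdiff i f * e i) \<in> P"
    using P_cong[of "Lam n 0 * (\<Sum>i<n. pdiff i f * e i)"] by simp
  then show False using P_prime Lam0 e(2) by blast
qed

definition admissible :: "nat \<Rightarrow> mpoly list \<Rightarrow> bool" where
  "admissible n g \<longleftrightarrow> g = [1 - (\<Sum>i<n. (Var i)\<^sup>2)] \<or> g = map (\<lambda>i. 1 - (Var i)\<^sup>2) [0..<n]
     \<or> g = map Var [0..<n] @ [1 - (\<Sum>i<n. Var i)]"

text \<open>If the multiplier of \<open>f\<close> vanished, the gradient and complementarity
  relations would force all other multipliers to vanish, against the last entry of
  \<open>h_FJ\<close>. These are polynomial identities, so they work modulo any prime ideal.\<close>

lemma (in prime_mod) Lam_0_notin: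
  assumes "admissible n g" and h: "set (h_FJ n f g) \<subseteq> P"
  shows "Lam n 0 \<notin> P"
proof
  assume L0: "Lam n 0 \<in> P"
  have grad: "(\<Sum>j<length g. Lam n (j + 1) * pdiff i (g ! j)) \<in> P" if "i < n" for i
  proof -
    have "Lam n 0 * pdiff i f - (\<Sum>j<length g. Lam n (j + 1) * pdiff i (g ! j)) \<in> P"
      using h h_FJ_mem(1)[OF that] by blast
    from P_diff[OF P_mult2[OF L0, of "pdiff i f"] this] show ?thesis by simp
  qed
  have comp: "Lam n (j + 1) * g ! j \<in> P" if "j < length g" for j using h h_FJ_mem(2)[OF that] by blast
  have half: "a \<in> P" if "- (2 * a) \<in> P" for a
  proof -
    have "Const (1/2) * 2 = Const (1/2 * 2)" by (simp only: Const_mult Const_numeral)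
    then have "Const (1/2) * 2 = 1" by simp
    then have "a = Const (- (1/2)) * - (2 * a)" by (simp add: Const_minus flip: mult.assoc)
    then show ?thesis using P_mult[OF that, of "Const (- (1/2))"] by simp
  qed
  have "Lam n (j + 1) \<in> P" if j: "j < length g" for j
    using assms(1) unfolding admissible_def
  proof (elim disjE)
    assume g: "g = [1 - (\<Sum>i<n. (Var i)\<^sup>2)]"
    let ?l = "Lam n 1"
    \<comment> \<open>From \<open>?l * Var i\<close> in \<open>P\<close> for all \<open>i\<close>,
      the product of \<open>?l\<close> with the squared norm is in \<open>P\<close>; adding the
      complementarity relation leaves \<open>?l\<close>.\<close>
    have "?l * Var i \<in> P" if "i < n" for i
    proof (rule half)
      have "(\<Sum>k<n. 2 * Var k * (if i = k then 1 else 0)) = 2 * Var i"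
        using that by (simp add: if_distrib cong: if_cong)
      then show "- (2 * (?l * Var i)) \<in> P" using grad[OF that] g that
        by (simp add: pdiff_simps mult_ac)
    qed
    then have "(\<Sum>i<n. ?l * Var i * Var i) \<in> P" by (intro P_sum) (simp add: P_mult2)
    moreover have "?l * (1 - (\<Sum>i<n. (Var i)\<^sup>2)) \<in> P" using comp[of 0] g by simp
    ultimately have "?l * (1 - (\<Sum>i<n. (Var i)\<^sup>2)) + (\<Sum>i<n. ?l * Var i * Var i) \<in> P" by (intro P_add)
    then show ?thesis using j g
      by (simp add: right_diff_distrib sum_distrib_left power2_eq_square mult.assoc)
  next
    assume g: "g = map (\<lambda>i. 1 - (Var i)\<^sup>2) [0..<n]"
    then have "j < n" using j by simp
    let ?l = "Lam n (j + 1)"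
    have "(\<Sum>k<n. Lam n (k + 1) * pdiff j (g ! k)) = (\<Sum>k<n. if k = j then - (2 * (?l * Var j)) else 0)"
      using g by (intro sum.cong) (auto simp: pdiff_simps mult_ac)
    then have "- (2 * (?l * Var j)) \<in> P" using grad[OF \<open>j < n\<close>] g \<open>j < n\<close> by simp
    then have "?l * Var j \<in> P" by (rule half)
    then have "?l * Var j * Var j + ?l * (1 - (Var j)\<^sup>2) \<in> P"
      using comp[OF j] g \<open>j < n\<close> by (intro P_add) (simp_all add: P_mult2)
    then show ?thesis by (simp add: right_diff_distrib power2_eq_square mult.assoc)
  next
    assume g: "g = map Var [0..<n] @ [1 - (\<Sum>i<n. Var i)]"
    let ?m = "Lam n (n + 1)"
    \<comment> \<open>The gradient relation makes all multipliers congruent to the last one,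
      \<open>?m\<close>. Complementarity then annihilates \<open>?m * Var i\<close>, and with the
      last constraint \<open>?m\<close> itself.\<close>
    have diff: "Lam n (i + 1) - ?m \<in> P" if "i < n" for i
    proof -
      have "(\<Sum>k<n. Lam n (k + 1) * pdiff i (g ! k)) = (\<Sum>k<n. if k = i then Lam n (i + 1) else 0)"
        using g by (intro sum.cong) (auto simp: pdiff_simps nth_append)
      moreover have "pdiff i (g ! n) = - 1"
        using g that by (simp add: nth_append pdiff_simps)
      ultimately show ?thesis using grad[OF that] g that by simp
    qed
    have "?m * Var i \<in> P" if "i < n" for i
    proof -
      have "Lam n (i + 1) * Var i \<in> P" using comp[of i] g that by (simp add: nth_append)
      from P_diff[OF this P_mult2[OF diff[OF that], of "Var i"]] show ?thesis by (simp add: algebra_simps)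
    qed
    then have "?m * (1 - (\<Sum>i<n. Var i)) + (\<Sum>i<n. ?m * Var i) \<in> P"
      using comp[of n] g by (intro P_add P_sum) (auto simp: nth_append)
    then have m: "?m \<in> P" by (simp add: right_diff_distrib sum_distrib_left)
    show ?thesis
    proof (cases "j < n")
      case True
      then show ?thesis using P_add[OF diff m] by simp
    next
      case False
      then have "j = n" using j g by simp
      then show ?thesis using m by simp
    qed
  qed
  then have "Lam n j \<in> P" if "j \<le> length g" for j
    using L0 that by (cases j) auto
  then have "(\<Sum>j\<le>length g. (Lam n j)\<^sup>2) \<in> P"
    by (intro P_sum) (simp add: power2_eq_square P_mult)
  then have "1 \<in> P" using P_add h h_FJ_mem(3)[of n g f] by force
  then show False by simp
qed

subsection \<open>Certificates\<close>

lemma SOS_0: "0 \<in> SOS N"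
  unfolding SOS_def by (rule CollectI, rule exI[of _ 0]) simp

lemma SOS_add_square:
  assumes "a \<in> SOS N" "q \<in> polys N"
  shows "a + q\<^sup>2 \<in> SOS N"
proof -
  obtain r :: nat and h where a: "a = (\<Sum>i<r. (h i)\<^sup>2)" "\<forall>i<r. h i \<in> polys N"
    using assms(1) unfolding SOS_def by blast
  have "a + q\<^sup>2 = (\<Sum>i<Suc r. ((h(r := q)) i)\<^sup>2)" using a(1) by simp
  moreover have "\<forall>i<Suc r. (h(r := q)) i \<in> polys N" using a(2) assms(2) by (simp add: less_Suc_eq)
  ultimately show ?thesis unfolding SOS_def by blast
qed

lemma SOS_square: "q \<in> polys N \<Longrightarrow> q\<^sup>2 \<in> SOS N"
  using SOS_add_square[OF SOS_0] by simp

lemma SOS_add: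
  assumes "a \<in> SOS N" "b \<in> SOS N"
  shows "a + b \<in> SOS N"
proof -
  obtain r :: nat and h where b: "b = (\<Sum>i<r. (h i)\<^sup>2)" "\<forall>i<r. h i \<in> polys N"
    using assms(2) unfolding SOS_def by blast
  have "a + (\<Sum>i<k. (h i)\<^sup>2) \<in> SOS N" if "k \<le> r" for k
    using that
  proof (induction k)
    case (Suc k)
    then have "(a + (\<Sum>i<k. (h i)\<^sup>2)) + (h k)\<^sup>2 \<in> SOS N" using b by (intro SOS_add_square) auto
    then show ?case by (simp add: add.assoc)
  qed (simp add: assms)
  then show ?thesis using b by simp
qed

lemma SOS_square_mult:
  assumes "a \<in> SOS N" "q \<in> polys N"
  shows "q\<^sup>2 * a \<in> SOS N"
proof -
  obtain r :: nat and h where a: "a = (\<Sum>i<r. (h i)\<^sup>2)" "\<forall>i<r. h i \<in> polys N"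
    using assms(1) unfolding SOS_def by blast
  have "q\<^sup>2 * a = (\<Sum>i<r. (q * h i)\<^sup>2)" using a by (simp add: sum_distrib_left power_mult_distrib)
  moreover have "\<forall>i<r. q * h i \<in> polys N" using a assms by simp
  ultimately show ?thesis unfolding SOS_def by (intro CollectI exI[of _ r] exI[of _ "\<lambda>i. q * h i"]) simp
qed

lemma SOS_Const_mult: "a \<in> SOS N \<Longrightarrow> c \<ge> 0 \<Longrightarrow> Const c * a \<in> SOS N"
  using SOS_square_mult[of a N "Const (sqrt c)"] by (simp flip: Const_power)

lemma eval_SOS: "a \<in> SOS N \<Longrightarrow> eval x a \<ge> 0"
  by (auto simp: SOS_def eval_simps intro!: sum_nonneg)

text \<open>The sets \<open>Q N k g + I N k h\<close> without the degree bounds; the bounds are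
  recovered once a single certificate is fixed.\<close>

definition cert :: "nat \<Rightarrow> mpoly list \<Rightarrow> mpoly list \<Rightarrow> mpoly set" where
  "cert N g h = {\<sigma>0 + (\<Sum>j<length g. \<sigma> j * g ! j) + (\<Sum>t<length h. \<psi> t * h ! t) | \<sigma>0 \<sigma> \<psi>.
     \<sigma>0 \<in> SOS N \<and> (\<forall>j<length g. \<sigma> j \<in> SOS N) \<and> (\<forall>t<length h. \<psi> t \<in> polys N)}"

lemma certI:
  "\<sigma>0 \<in> SOS N \<Longrightarrow> (\<And>j. j < length g \<Longrightarrow> \<sigma> j \<in> SOS N) \<Longrightarrow> (\<And>t. t < length h \<Longrightarrow> \<psi> t \<in> polys N) \<Longrightarrow>
    \<sigma>0 + (\<Sum>j<length g. \<sigma> j * g ! j) + (\<Sum>t<length h. \<psi> t * h ! t) \<in> cert N g h"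
  unfolding cert_def by blast

lemma certE:
  assumes "a \<in> cert N g h"
  obtains \<sigma>0 \<sigma> \<psi> where "a = \<sigma>0 + (\<Sum>j<length g. \<sigma> j * g ! j) + (\<Sum>t<length h. \<psi> t * h ! t)"
    "\<sigma>0 \<in> SOS N" "\<And>j. j < length g \<Longrightarrow> \<sigma> j \<in> SOS N" "\<And>t. t < length h \<Longrightarrow> \<psi> t \<in> polys N"
  using assms unfolding cert_def by blast

lemma cert_add:
  assumes "a \<in> cert N g h" "b \<in> cert N g h"
  shows "a + b \<in> cert N g h"
proof -
  obtain \<sigma>0 \<sigma> \<psi> where a: "a = \<sigma>0 + (\<Sum>j<length g. \<sigma> j * g ! j) + (\<Sum>t<length h. \<psi> t * h ! t)"
    "\<sigma>0 \<in> SOS N" "\<And>j. j < length g \<Longrightarrow> \<sigma> j \<in> SOS N" "\<And>t. t < length h \<Longrightarrow> \<psi> t \<in> polys N"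
    using assms(1) by (rule certE) blast
  obtain \<tau>0 \<tau> \<chi> where b: "b = \<tau>0 + (\<Sum>j<length g. \<tau> j * g ! j) + (\<Sum>t<length h. \<chi> t * h ! t)"
    "\<tau>0 \<in> SOS N" "\<And>j. j < length g \<Longrightarrow> \<tau> j \<in> SOS N" "\<And>t. t < length h \<Longrightarrow> \<chi> t \<in> polys N"
    using assms(2) by (rule certE) blast
  have "a + b = (\<sigma>0 + \<tau>0) + (\<Sum>j<length g. (\<sigma> j + \<tau> j) * g ! j) + (\<Sum>t<length h. (\<psi> t + \<chi> t) * h ! t)"
    by (simp add: a(1) b(1) distrib_right sum.distrib)
  also have "\<dots> \<in> cert N g h" using a b by (intro certI SOS_add polys_add)
  finally show ?thesis .
qed

lemma cert_square_mult:
  assumes "a \<in> cert N g h" "q \<in> polys N"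
  shows "q\<^sup>2 * a \<in> cert N g h"
proof -
  obtain \<sigma>0 \<sigma> \<psi> where a: "a = \<sigma>0 + (\<Sum>j<length g. \<sigma> j * g ! j) + (\<Sum>t<length h. \<psi> t * h ! t)"
    "\<sigma>0 \<in> SOS N" "\<And>j. j < length g \<Longrightarrow> \<sigma> j \<in> SOS N" "\<And>t. t < length h \<Longrightarrow> \<psi> t \<in> polys N"
    using assms(1) by (rule certE) blast
  have "q\<^sup>2 * a = q\<^sup>2 * \<sigma>0 + (\<Sum>j<length g. q\<^sup>2 * \<sigma> j * g ! j) + (\<Sum>t<length h. q\<^sup>2 * \<psi> t * h ! t)"
    by (simp add: a(1) distrib_left sum_distrib_left mult.assoc)
  also have "\<dots> \<in> cert N g h" using a assms by (intro certI SOS_square_mult polys_mult polys_power)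
  finally show ?thesis .
qed

lemma cert_SOS: "a \<in> SOS N \<Longrightarrow> a \<in> cert N g h"
  using certI[of a N g "\<lambda>_. 0" h "\<lambda>_. 0"] by (simp add: SOS_0)

lemma cert_sum: "(\<And>i. i \<in> F \<Longrightarrow> p i \<in> cert N g h) \<Longrightarrow> sum p F \<in> cert N g h"
  by (induction F rule: infinite_finite_induct) (simp_all add: cert_SOS SOS_0 cert_add)

lemma cert_constraint:
  assumes "j < length g"
  shows "g ! j \<in> cert N g h"
proof -
  have "(\<Sum>k<length g. (if k = j then 1\<^sup>2 else 0) * g ! k) = (\<Sum>k<length g. if k = j then g ! j else 0)"
    by (rule sum.cong) auto
  then show ?thesis
    using certI[of 0 N g "\<lambda>k. if k = j then 1\<^sup>2 else 0" h "\<lambda>_. 0"] assms SOS_square[of 1 N]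
    by (auto simp: SOS_0)
qed

lemma cert_ideal:
  assumes "p \<in> set h" "q \<in> polys N"
  shows "q * p \<in> cert N g h"
proof -
  obtain t where t: "t < length h" "p = h ! t" using assms by (metis in_set_conv_nth)
  have "(\<Sum>k<length h. (if k = t then q else 0) * h ! k) = (\<Sum>k<length h. if k = t then q * p else 0)"
    using t by (intro sum.cong) auto
  then show ?thesis
    using certI[of 0 N g "\<lambda>_. 0" h "\<lambda>k. if k = t then q else 0"] assms t
    by (auto simp: SOS_0)
qed

text \<open>
  Setting the variables \<open>\<ge> N\<close> to zero transports a quadratic module of \<open>polys N\<close> to the type of
  polynomials in all variables.
\<close>

definition retract :: "nat \<Rightarrow> mpoly \<Rightarrow> mpoly" where
  "retract N = subst Const (\<lambda>i. if i < N then Var i else 0)"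

lemmas retract_simps = Const.subst_simps[of "\<lambda>i. if i < N then Var i else 0" for N, folded retract_def]

lemma retract_polys: "retract N p \<in> polys N"
  by (induction p rule: mpoly_induct) (simp_all add: retract_simps)

lemma retract_id: "p \<in> polys N \<Longrightarrow> retract N p = p"
  by (induction rule: polys_induct) (simp_all add: retract_simps)

lemma qmodule_retract_cert: "qmodule {a. retract N a \<in> cert N g h}"
  unfolding qmodule_def
  using cert_SOS[OF SOS_square[of 1 N]]
  by (auto simp: retract_simps intro: cert_add cert_square_mult retract_polys)

lemma cert_Var_bounded:
  assumes "admissible n g" and i: "i < n" and N: "n \<le> N"
  shows "\<exists>r. Const r - (Var i)\<^sup>2 \<in> cert N g h"
  using assms(1) unfolding admissible_def
proof (elim disjE)
  assume g: "g = [1 - (\<Sum>i<n. (Var i)\<^sup>2)]"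
  have "(\<Sum>k\<in>{..<n} - {i}. (Var k)\<^sup>2) \<in> cert N g h"
    using N by (intro cert_sum cert_SOS SOS_square polys_Var) auto
  then have "g ! 0 + (\<Sum>k\<in>{..<n} - {i}. (Var k)\<^sup>2) \<in> cert N g h"
    using g by (intro cert_add cert_constraint) simp_all
  moreover have "g ! 0 + (\<Sum>k\<in>{..<n} - {i}. (Var k)\<^sup>2) = Const 1 - (Var i)\<^sup>2"
    using g i by (simp add: sum.remove[of "{..<n}" i])
  ultimately show ?thesis by metis
next
  assume "g = map (\<lambda>i. 1 - (Var i)\<^sup>2) [0..<n]"
  then have "Const 1 - (Var i)\<^sup>2 \<in> cert N g h" using cert_constraint[of i g N h] i by simp
  then show ?thesis by blast
next
  assume g: "g = map Var [0..<n] @ [1 - (\<Sum>i<n. Var i)]"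
  have 0: "Var k \<in> cert N g h" if "k < n" for k
    using cert_constraint[of k g N h] g that by (simp add: nth_append)
  have "g ! n + (\<Sum>k\<in>{..<n} - {i}. Var k) \<in> cert N g h"
    using g by (intro cert_add cert_constraint cert_sum 0) auto
  moreover have "g ! n + (\<Sum>k\<in>{..<n} - {i}. Var k) = 1 - Var i"
    using g i by (simp add: nth_append sum.remove[of "{..<n}" i])
  ultimately have 1: "1 - Var i \<in> cert N g h" by simp
  \<comment> \<open>With \<open>x\<close> for the variable,
    \<open>1 - x^2 = x (1 - x) + (1 - x)\<close>. The product \<open>x (1 - x)\<close> becomes
    available after multiplication by \<open>x + (1 - x) = 1\<close>, which gives the first two
    terms.\<close>
  have "(Var i)\<^sup>2 * (1 - Var i) + (1 - Var i)\<^sup>2 * Var i + (1 - Var i) \<in> cert N g h"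
    using 0 1 i N by (intro cert_add cert_square_mult) auto
  also have "(Var i)\<^sup>2 * (1 - Var i) + (1 - Var i)\<^sup>2 * Var i + (1 - Var i) = Const 1 - (Var i)\<^sup>2"
    by (simp add: power2_eq_square algebra_simps)
  finally show ?thesis by blast
qed

text \<open>Failure of the conclusion says exactly that the module pulled back along
  \<open>retract\<close> avoids \<open>T\<close>, so it extends to a maximal one.\<close>

lemma ex_cert_product:
  assumes f: "f \<in> polys n" and g: "set g \<subseteq> polys n" and adm: "admissible n g"
    and min: "\<And>y. (\<And>j. j < length g \<Longrightarrow> eval y (g ! j) \<ge> 0) \<Longrightarrow> f0 \<le> eval y f"
  shows "\<exists>cs. set cs \<subseteq> {f0..} \<and>
    - ((\<Prod>c\<leftarrow>cs. f - Const c)\<^sup>2) \<in> cert (nz n g) g (h_FJ n f g)"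
proof (rule ccontr)
  let ?N = "nz n g" and ?h = "h_FJ n f g"
  let ?C = "cert ?N g ?h"
  let ?M = "{a. retract ?N a \<in> ?C}"
  define T where "T = {\<Prod>c\<leftarrow>cs. f - Const c |cs. set cs \<subseteq> {f0..}}"
  assume no: "\<not> ?thesis"
  have nN: "n \<le> ?N" by (simp add: nz_def)
  have CM: "a \<in> ?M" if "a \<in> ?C" "a \<in> polys ?N" for a using that by (simp add: retract_id)
  have gN: "g ! j \<in> polys ?N" if "j < length g" for j
    using g nth_mem[OF that] by (intro polys_mono[OF nN]) blast
  have hN: "p \<in> polys ?N" if "p \<in> set ?h" for p using h_FJ_polys[OF f g that] .
  have fN: "f \<in> polys ?N" using polys_mono[OF nN f] .
  have Tpolys: "t \<in> polys ?N" if "t \<in> T" for t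
  proof -
    have "(\<Prod>c\<leftarrow>cs. f - Const c) \<in> polys ?N" for cs by (induction cs) (simp_all add: fN)
    then show ?thesis using that unfolding T_def by blast
  qed
  have T_I: "(\<Prod>c\<leftarrow>cs. f - Const c) \<in> T" if "set cs \<subseteq> {f0..}" for cs
    using that unfolding T_def by blast
  have T1: "1 \<in> T" using T_I[of "[]"] by simp
  have Tmult: "t * u \<in> T" if "t \<in> T" "u \<in> T" for t u
  proof -
    obtain cs where cs: "set cs \<subseteq> {f0..}" "t = (\<Prod>c\<leftarrow>cs. f - Const c)"
      using \<open>t \<in> T\<close> unfolding T_def by blast
    obtain ds where ds: "set ds \<subseteq> {f0..}" "u = (\<Prod>c\<leftarrow>ds. f - Const c)"
      using \<open>u \<in> T\<close> unfolding T_def by blast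
    show ?thesis using T_I[of "cs @ ds"] cs ds by simp
  qed
  have avoid: "- (t\<^sup>2) \<notin> ?M" if "t \<in> T" for t
  proof
    assume "- (t\<^sup>2) \<in> ?M"
    then have "- (t\<^sup>2) \<in> ?C" using Tpolys[OF that] by (simp add: retract_id)
    then show False using no that unfolding T_def by blast
  qed
  obtain N where max: "?M \<subseteq> N" "maximal_qmodule T N"
  proof (rule ex_maximal_qmodule[OF T1 _ qmodule_retract_cert])
    show "t * u \<in> T" if "t \<in> T" "u \<in> T" for t u using that by (rule Tmult)
    show "- (t\<^sup>2) \<notin> ?M" if "t \<in> T" for t using that by (rule avoid)
  qed
  interpret maximal_qmodule T N by (rule max(2))
  interpret prime_mod "supp N" using supp_prime by unfold_locales
  have h: "set ?h \<subseteq> supp N"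
  proof
    fix p assume p: "p \<in> set ?h"
    have "1 * p \<in> ?C" "(- 1) * p \<in> ?C" using p by (rule cert_ideal; simp)+
    then have "p \<in> ?M" "- p \<in> ?M" using hN[OF p] by (simp_all add: retract_id)
    then show "p \<in> supp N" using max(1) by (simp only: supp_def mem_Collect_eq subset_iff)
  qed
  obtain c where c: "f - Const c \<in> supp N"
  proof -
    have "\<exists>c. f - Const c \<in> supp N"
      by (rule critical_value[OF supp_prime _ h Lam_0_notin[OF adm h] f g]) (rule supp_sum_sq)
    then show ?thesis using that by blast
  qed
  have "c < f0"
  proof (rule ccontr)
    assume "\<not> c < f0"
    then have "f - Const c \<in> T" using T_I[of "[c]"] by simp
    then show False using supp_avoids c by blast
  qed
  have bound: "\<exists>r. Const r - (Var i)\<^sup>2 \<in> N" for i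
  proof -
    consider "i < n" | "i \<ge> n" "i < ?N" | "i \<ge> ?N" by linarith
    then show ?thesis
    proof cases
      case 1
      then obtain r where "Const r - (Var i)\<^sup>2 \<in> ?C" using cert_Var_bounded[OF adm _ nN] by blast
      moreover have "Const r - (Var i)\<^sup>2 \<in> polys ?N" using 1 nN by simp
      ultimately show ?thesis using CM max(1) by blast
    next
      case 2
      \<comment> \<open>The multipliers are bounded by the sphere relation, which lies in the
        support.\<close>
      define j where "j = i - n"
      have j: "i = n + j" "j \<le> length g" using 2 by (auto simp: j_def nz_def)
      have "(\<Sum>k\<in>{..length g} - {j}. (Lam n k)\<^sup>2) \<in> N"
        using N by (intro qmodule_sum qmodule_sq)
      moreover have "1 - (\<Sum>k\<le>length g. (Lam n k)\<^sup>2) \<in> N"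
        using h h_FJ_mem(3)[of n g f] by (auto simp: supp_def)
      ultimately have "1 - (\<Sum>k\<le>length g. (Lam n k)\<^sup>2) + (\<Sum>k\<in>{..length g} - {j}. (Lam n k)\<^sup>2) \<in> N"
        using N by (intro qmodule_add)
      moreover have "1 - (\<Sum>k\<le>length g. (Lam n k)\<^sup>2) + (\<Sum>k\<in>{..length g} - {j}. (Lam n k)\<^sup>2) = Const 1 - (Var i)\<^sup>2"
        using j by (simp add: sum.remove[of "{..length g}" j] Lam_def)
      ultimately show ?thesis by metis
    next
      \<comment> \<open>Variables outside the ring are sent to 0 by \<open>retract\<close>, so 0
        bounds their squares.\<close>
      case 3
      then have "Const 0 - (Var i)\<^sup>2 \<in> ?M" by (simp add: retract_simps cert_SOS SOS_0)
      then show ?thesis using max(1) by blast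
    qed
  qed
  interpret total_archimedean N
  proof unfold_locales
    show "bounded_in N a" for a using bounded_in_all[OF N bound] .
    show "- 1 \<notin> N" using maximal_qmodule.avoid[OF max(2) T1] by simp
  qed (use N total in auto)
  obtain y where y: "\<And>p. p \<in> N \<Longrightarrow> eval y p \<ge> 0" using ex_point by blast
  have "eval y (g ! j) \<ge> 0" if "j < length g" for j
    using y max(1) CM[OF cert_constraint gN] that by blast
  then have "f0 \<le> eval y f" by (rule min)
  moreover have "eval y (f - Const c) \<ge> 0" "eval y (- (f - Const c)) \<ge> 0"
    using c y by (auto simp only: supp_def)
  ultimately show False using \<open>c < f0\<close> by (simp add: eval_simps)
qed

section \<open>Certificates of a degree independent of the error\<close>

text \<open>Completing the square: the coefficient of \<open>u\<^sup>2\<close> is chosen so that the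
  sum is the square of \<open>sqrt \<epsilon> + (a / (2 * sqrt \<epsilon>)) * u\<close>.\<close>

lemma SOS_quadratic:
  assumes "u \<in> polys N" "\<epsilon> > 0"
  shows "Const \<epsilon> + Const a * u + Const (a\<^sup>2 / (4 * \<epsilon>)) * u\<^sup>2 \<in> SOS N"
proof -
  define b where "b = a / (2 * sqrt \<epsilon>)"
  have b: "Const \<epsilon> = Const (sqrt \<epsilon>) * Const (sqrt \<epsilon>)" "Const a = Const (sqrt \<epsilon>) * Const b + Const (sqrt \<epsilon>) * Const b"
    "Const (a\<^sup>2 / (4 * \<epsilon>)) = Const b * Const b"
    unfolding Const_mult[symmetric] Const_add[symmetric] using \<open>\<epsilon> > 0\<close>
    by (simp_all add: b_def flip: power2_eq_square add: power_divide power_mult_distrib)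
  have "Const \<epsilon> + Const a * u + Const (a\<^sup>2 / (4 * \<epsilon>)) * u\<^sup>2 = (Const (sqrt \<epsilon>) + Const b * u)\<^sup>2"
    unfolding b by (simp add: power2_eq_square algebra_simps)
  then show ?thesis using assms by (simp add: SOS_square)
qed

text \<open>
  The sums of squares below have a degree that does not depend on \<open>\<epsilon>\<close>; this is why a
  single order of the hierarchy serves all \<open>\<epsilon>\<close>.
\<close>

lemma SOS_absorb:
  assumes u: "u \<in> polys N"
  shows "\<epsilon> > 0 \<Longrightarrow> \<exists>C\<ge>0. Const \<epsilon> + Const a * u + Const C * u ^ (2 ^ Suc k) \<in> SOS N"
proof (induction k arbitrary: \<epsilon>)
  case 0
  then show ?case using SOS_quadratic[OF u, of \<epsilon> a] by (intro exI[of _ "a\<^sup>2 / (4 * \<epsilon>)"]) simp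
next
  case (Suc k)
  let ?m = "2 ^ Suc k :: nat"
  obtain C where C: "C \<ge> 0" "Const (\<epsilon> / 2) + Const a * u + Const C * u ^ ?m \<in> SOS N"
    using Suc.IH[of "\<epsilon> / 2"] Suc.prems by auto
  \<comment> \<open>One half of \<open>\<epsilon>\<close> pays for the induction hypothesis; the
    other half trades the term \<open>C * u ^ ?m\<close> for one with the doubled exponent, by
    completing a square again.\<close>
  define C' where "C' = (- C)\<^sup>2 / (4 * (\<epsilon> / 2))"
  have "Const (\<epsilon> / 2) + Const (- C) * u ^ ?m + Const C' * (u ^ ?m)\<^sup>2 \<in> SOS N"
    unfolding C'_def using Suc.prems u by (intro SOS_quadratic) simp_all
  from SOS_add[OF C(2) this]
  have "(Const (\<epsilon> / 2) + Const (\<epsilon> / 2)) + Const a * u + Const C' * (u ^ ?m)\<^sup>2 \<in> SOS N"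
    by (simp add: Const_minus algebra_simps)
  moreover have "(u ^ ?m)\<^sup>2 = u ^ (2 ^ Suc (Suc k))"
    by (simp add: power_mult[symmetric] mult.commute)
  ultimately have "Const \<epsilon> + Const a * u + Const C' * u ^ (2 ^ Suc (Suc k)) \<in> SOS N"
    by (simp only: Const_add[symmetric] field_sum_of_halves)
  moreover have "C' \<ge> 0" using Suc.prems by (simp add: C'_def)
  ultimately show ?case by blast
qed

lemma ex_interpolation:
  fixes v :: "real \<Rightarrow> real"
  assumes "finite C"
  shows "\<exists>q. \<forall>c\<in>C. poly q c = v c"
  using assms
proof (induction C rule: finite_induct)
  case (insert c C)
  then obtain q where q: "\<forall>c\<in>C. poly q c = v c" by blast
  let ?w = "\<Prod>b\<in>C. [:- b, 1:]"
  have w: "poly ?w c \<noteq> 0" "\<forall>b\<in>C. poly ?w b = 0"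
    using insert by (auto simp: poly_prod)
  have "poly (q + smult ((v c - poly q c) / poly ?w c) ?w) b = v b" if "b \<in> insert c C" for b
    using that q w by auto
  then show ?case by blast
qed simp

lemma cert_power:
  assumes f: "f \<in> polys N" and cs: "set cs \<subseteq> {f0..}"
    and cert: "- ((\<Prod>c\<leftarrow>cs. f - Const c)\<^sup>2) \<in> cert N g h"
  shows "\<exists>q k. - ((f - Const f0 - (poly (map_poly Const q) f)\<^sup>2) ^ (2 ^ Suc k)) \<in> cert N g h"
proof -
  \<comment> \<open>The square roots are real because every listed value is at least
    \<open>f0\<close>.\<close>
  obtain q where q: "\<forall>c\<in>set cs. poly q c = sqrt (c - f0)" using ex_interpolation[of "set cs" "\<lambda>c. sqrt (c - f0)"] by auto
  define r where "r = [:- f0, 1:] - q\<^sup>2"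
  \<comment> \<open>Each entry of the list is paid for by one factor \<open>r\<close>, so repeated
    entries are allowed.\<close>
  have "(\<Prod>c\<leftarrow>ds. [:- c, 1:]) dvd r ^ length ds" if "set ds \<subseteq> set cs" for ds
    using that
  proof (induction ds)
    case (Cons c ds)
    then have "poly r c = 0" using q cs by (auto simp: r_def)
    then have "[:- c, 1:] dvd r" by (simp add: poly_eq_0_iff_dvd)
    then show ?case using Cons by (simp add: mult_dvd_mono del: dvd_smult_iff mult_pCons_left)
  qed simp
  then have "(\<Prod>c\<leftarrow>cs. [:- c, 1:]) dvd r ^ length cs" by simp
  \<comment> \<open>The exponent is raised to a power of 2, the form required by
    \<open>SOS_absorb\<close>.\<close>
  also have "\<dots> dvd r ^ (2 ^ length cs)" by (intro le_imp_power_dvd less_imp_le less_exp)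
  finally obtain s where s: "r ^ (2 ^ length cs) = (\<Prod>c\<leftarrow>cs. [:- c, 1:]) * s" by (elim dvdE)
  define ev where "ev p = poly (map_poly Const p) f" for p
  have prod: "ev (\<Prod>c\<leftarrow>ds. [:- c, 1:]) = (\<Prod>c\<leftarrow>ds. f - Const c)" for ds
    by (induction ds) (simp_all add: ev_def map_poly_1 poly_Const_mult map_poly_pCons Const_minus del: mult_pCons_left)
  have "ev ([:- f0, 1:] - q\<^sup>2) + ev (q\<^sup>2) = ev [:- f0, 1:]"
    unfolding ev_def poly_Const_add[symmetric] by simp
  then have ev_r: "ev r = f - Const f0 - (ev q)\<^sup>2"
    by (simp add: r_def ev_def map_poly_pCons Const_minus poly_Const_power algebra_simps)
  have "(ev r) ^ (2 ^ length cs) = (\<Prod>c\<leftarrow>cs. f - Const c) * ev s"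
    using arg_cong[OF s, of ev] unfolding ev_def poly_Const_mult poly_Const_power
    by (simp add: prod[unfolded ev_def])
  \<comment> \<open>Squaring makes the cofactor a square, the only kind of multiplier that keeps
    \<open>- (t\<^sup>2)\<close> in \<open>cert\<close>.\<close>
  then have "((ev r) ^ (2 ^ length cs))\<^sup>2 = (ev s)\<^sup>2 * (\<Prod>c\<leftarrow>cs. f - Const c)\<^sup>2"
    by (simp add: power_mult_distrib mult.commute)
  moreover have "((ev r) ^ (2 ^ length cs))\<^sup>2 = (ev r) ^ (2 ^ Suc (length cs))"
    by (simp add: power_mult[symmetric] mult.commute)
  ultimately have "- ((ev r) ^ (2 ^ Suc (length cs))) = (ev s)\<^sup>2 * - ((\<Prod>c\<leftarrow>cs. f - Const c)\<^sup>2)"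
    by simp
  also have "\<dots> \<in> cert N g h"
    using cert f by (intro cert_square_mult) (simp_all add: ev_def poly_Const_polys)
  finally show ?thesis unfolding ev_r unfolding ev_def by blast
qed

lemma uniform_order:
  assumes f: "f \<in> polys N"
    and cert: "- ((f - Const f0 - (poly (map_poly Const q) f)\<^sup>2) ^ (2 ^ Suc k)) \<in> cert N g h"
  shows "\<exists>d. \<forall>\<epsilon>>0. f - Const (f0 - \<epsilon>) \<in> Q N d g + I N d h"
proof -
  define p where "p = poly (map_poly Const q) f"
  define u where "u = f - Const f0 - p\<^sup>2"
  have p: "p \<in> polys N" and u: "u \<in> polys N" using f by (simp_all add: p_def u_def poly_Const_polys)
  let ?K = "2 ^ Suc k :: nat"
  obtain \<sigma>0 \<sigma> \<psi> where w: "- (u ^ ?K) = \<sigma>0 + (\<Sum>j<length g. \<sigma> j * g ! j) + (\<Sum>t<length h. \<psi> t * h ! t)"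
    "\<sigma>0 \<in> SOS N" "\<And>j. j < length g \<Longrightarrow> \<sigma> j \<in> SOS N" "\<And>t. t < length h \<Longrightarrow> \<psi> t \<in> polys N"
    using cert unfolding u_def p_def by (rule certE) blast
  \<comment> \<open>Only ingredients free of \<open>\<epsilon>\<close> are collected. Later
    \<open>\<epsilon>\<close> and \<open>C\<close> enter as scalars alone, and scalars do not raise
    degrees.\<close>
  define d where "d = Max (tdeg ` ({p\<^sup>2, u, u ^ ?K, \<sigma>0} \<union> (\<lambda>j. \<sigma> j * g ! j) ` {..<length g}
      \<union> (\<lambda>t. \<psi> t * h ! t) ` {..<length h}))"
  have d: "tdeg x \<le> 2 * d" if "x \<in> {p\<^sup>2, u, u ^ ?K, \<sigma>0} \<union> (\<lambda>j. \<sigma> j * g ! j) ` {..<length g}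
      \<union> (\<lambda>t. \<psi> t * h ! t) ` {..<length h}" for x
  proof -
    have "tdeg x \<le> d" unfolding d_def by (rule Max_ge) (use that in auto)
    then show ?thesis by simp
  qed
  show ?thesis
  proof (intro exI allI impI)
    fix \<epsilon> :: real assume "\<epsilon> > 0"
    then obtain C where C: "C \<ge> 0" "Const \<epsilon> + Const 1 * u + Const C * u ^ ?K \<in> SOS N"
      using SOS_absorb[OF u] by blast
    define s where "s = Const \<epsilon> + Const 1 * u + Const C * u ^ ?K"
    let ?A = "(p\<^sup>2 + s + Const C * \<sigma>0) + (\<Sum>j<length g. (Const C * \<sigma> j) * g ! j)"
    let ?B = "\<Sum>t<length h. (Const C * \<psi> t) * h ! t"
    have "f - Const (f0 - \<epsilon>) = p\<^sup>2 + s + Const C * - (u ^ ?K)"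
      by (simp add: s_def u_def Const_diff algebra_simps)
    also have "\<dots> = ?A + ?B" unfolding w(1) by (simp add: distrib_left sum_distrib_left mult.assoc)
    finally have eq: "f - Const (f0 - \<epsilon>) = ?A + ?B" .
    have "p\<^sup>2 + s + Const C * \<sigma>0 \<in> SOS N"
      using C w p by (intro SOS_add SOS_square SOS_Const_mult) (simp_all add: s_def)
    moreover have "tdeg (p\<^sup>2 + s + Const C * \<sigma>0) \<le> 2 * d"
      unfolding s_def by (intro tdeg_add_le tdeg_Const_mult_le) (auto intro: d)
    moreover have "Const C * \<sigma> j \<in> SOS N \<and> tdeg ((Const C * \<sigma> j) * g ! j) \<le> 2 * d" if "j < length g" for j
      using that C w unfolding mult.assoc by (intro conjI SOS_Const_mult tdeg_Const_mult_le d) simp_all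
    ultimately have A: "?A \<in> Q N d g"
      unfolding Q_def
      by (intro CollectI exI[of _ "p\<^sup>2 + s + Const C * \<sigma>0"] exI[of _ "\<lambda>j. Const C * \<sigma> j"]) blast
    have "Const C * \<psi> t \<in> polys N \<and> tdeg ((Const C * \<psi> t) * h ! t) \<le> 2 * d" if "t < length h" for t
      using that w unfolding mult.assoc by (intro conjI polys_mult tdeg_Const_mult_le d) simp_all
    then have "?B \<in> I N d h"
      unfolding I_def by (intro CollectI exI[of _ "\<lambda>t. Const C * \<psi> t"]) blast
    then show "f - Const (f0 - \<epsilon>) \<in> Q N d g + I N d h" unfolding eq using A by (intro set_plus_intro)
  qed
qed

subsection \<open>Fritz John multipliers\<close>

lemma eval_numeral [simp]: "eval x (numeral k) = numeral k"
  using eval.subst_Const[of x "numeral k"] by (simp add: eval_eq_subst Const_numeral)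

definition dderiv :: "nat \<Rightarrow> (nat \<Rightarrow> real) \<Rightarrow> (nat \<Rightarrow> real) \<Rightarrow> mpoly \<Rightarrow> real" where
  "dderiv n x v p = (\<Sum>i<n. eval x (pdiff i p) * v i)"

lemma DERIV_eval_line:
  assumes "p \<in> polys n"
  shows "((\<lambda>t. eval (\<lambda>i. x i + t * v i) p) has_real_derivative dderiv n x v p) (at 0)"
  using assms
proof (induction rule: polys_induct)
  case (Const c)
  then show ?case by (simp add: dderiv_def eval_simps)
next
  case (Var i)
  then have "dderiv n x v (Var i) = (\<Sum>k<n. if k = i then v i else 0)"
    unfolding dderiv_def by (intro sum.cong) (auto simp: pdiff_Var eval_simps)
  then have "dderiv n x v (Var i) = v i" using Var by simp
  then show ?case by (auto simp: eval_simps intro!: derivative_eq_intros)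
next
  case (add p q)
  have "dderiv n x v (p + q) = dderiv n x v p + dderiv n x v q"
    by (simp add: dderiv_def pdiff_add eval_simps distrib_right sum.distrib)
  then show ?case using DERIV_add[OF add] by (simp add: eval_simps)
next
  case (mult p q)
  have "dderiv n x v (p * q) = dderiv n x v p * eval x q + dderiv n x v q * eval x p"
    by (simp add: dderiv_def pdiff_mult eval_simps sum.distrib sum_distrib_left algebra_simps)
  then show ?case using DERIV_mult[OF mult] by (simp add: eval_simps)
qed

lemma eventually_feasible:
  assumes p: "p \<in> polys n" and "eval x p > 0 \<or> eval x p = 0 \<and> dderiv n x v p > 0"
  shows "\<forall>\<^sub>F t in at_right 0. eval (\<lambda>i. x i + t * v i) p \<ge> 0"
proof -
  let ?F = "\<lambda>t. eval (\<lambda>i. x i + t * v i) p"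
  note D = DERIV_eval_line[OF p, of x v]
  show ?thesis using assms(2)
  proof
    assume "eval x p > 0"
    have "(?F \<longlongrightarrow> ?F 0) (at_right 0)"
      using DERIV_isCont[OF D] by (auto simp: isCont_def intro: tendsto_within_subset)
    then have "\<forall>\<^sub>F t in at_right 0. ?F t > 0"
      by (rule order_tendstoD) (use \<open>eval x p > 0\<close> in simp)
    then show ?thesis by (rule eventually_mono) simp
  next
    assume *: "eval x p = 0 \<and> dderiv n x v p > 0"
    then obtain d where d: "d > 0" "\<And>t. 0 < t \<Longrightarrow> t < d \<Longrightarrow> ?F 0 < ?F (0 + t)"
      using DERIV_pos_inc_right[OF D] by blast
    then show ?thesis using * unfolding eventually_at_right_field
      by (intro exI[of _ d]) (auto intro!: less_imp_le)
  qed
qed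

locale minimizer =
  fixes n :: nat and f :: mpoly and g :: "mpoly list" and x :: "nat \<Rightarrow> real"
  assumes f: "f \<in> polys n" and g: "set g \<subseteq> polys n"
    and feasible: "j < length g \<Longrightarrow> eval x (g ! j) \<ge> 0"
    and min: "(\<And>j. j < length g \<Longrightarrow> eval y (g ! j) \<ge> 0) \<Longrightarrow> eval x f \<le> eval y f"
begin

text \<open>A direction of descent that stays feasible to first order would contradict minimality.
  The third alternative admits active constraints that the direction does not change, such as those
  on other coordinates.\<close>

lemma dderiv_nonneg:
  assumes "\<And>j. j < length g \<Longrightarrow> eval x (g ! j) > 0 \<or> eval x (g ! j) = 0 \<and> dderiv n x v (g ! j) > 0
    \<or> (\<forall>t. eval (\<lambda>i. x i + t * v i) (g ! j) = eval x (g ! j))"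
  shows "dderiv n x v f \<ge> 0"
proof (rule ccontr)
  assume "\<not> ?thesis"
  then obtain d where d: "d > 0" "\<And>t. 0 < t \<Longrightarrow> t < d \<Longrightarrow> eval (\<lambda>i. x i + t * v i) f < eval x f"
    using DERIV_neg_dec_right[OF DERIV_eval_line[OF f, of x v]] by auto
  have "\<forall>\<^sub>F t in at_right 0. \<forall>j\<in>{..<length g}. eval (\<lambda>i. x i + t * v i) (g ! j) \<ge> 0"
  proof (intro eventually_ball_finite ballI)
    fix j assume j: "j \<in> {..<length g}"
    then have "g ! j \<in> polys n" using g nth_mem[of j g] by auto
    then show "\<forall>\<^sub>F t in at_right 0. eval (\<lambda>i. x i + t * v i) (g ! j) \<ge> 0"
      using assms[of j] feasible[of j] j eventually_feasible[of "g ! j"] by auto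
  qed simp
  moreover have "\<forall>\<^sub>F t in at_right 0. t < d" "\<forall>\<^sub>F t in at_right (0::real). t > 0"
    using d(1) by (auto simp: eventually_at_right_field)
  ultimately have "\<forall>\<^sub>F t in at_right (0::real). False"
  proof eventually_elim
    case (elim t)
    have "eval x f \<le> eval (\<lambda>i. x i + t * v i) f" by (rule min) (use elim in simp)
    then show False using d(2)[of t] elim by simp
  qed
  then show False by (simp add: trivial_limit_at_right_real)
qed

text \<open>In the interior, the direction of steepest descent shows that the gradient
  \<open>D\<close> is 0. On the sphere, tangential descent gives \<open>|D|^2 \<le> b^2\<close> with
  \<open>b\<close> the inner product of \<open>D\<close> and \<open>x\<close>; this is equality in
  Cauchy-Schwarz, so \<open>D = b x\<close>.\<close>

lemma multipliers_ball:
  assumes g: "g = [1 - (\<Sum>i<n. (Var i)\<^sup>2)]"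
  shows "\<exists>\<mu>. (\<forall>i<n. eval x (pdiff i f) = (\<Sum>j<length g. \<mu> j * eval x (pdiff i (g ! j))))
    \<and> (\<forall>j<length g. \<mu> j * eval x (g ! j) = 0)"
proof -
  define D where "D i = eval x (pdiff i f)" for i
  define s where "s = (\<Sum>i<n. (x i)\<^sup>2)"
  have g0: "eval x (g ! 0) = 1 - s" using g by (simp add: eval_simps s_def)
  have pd: "eval x (pdiff i (g ! 0)) = - 2 * x i" if "i < n" for i
  proof -
    have "(\<Sum>k<n. 2 * x k * (if i = k then 1 else 0)) = (\<Sum>k<n. if k = i then 2 * x i else 0)"
      by (intro sum.cong) auto
    then show ?thesis using g that
      by (simp add: pdiff_simps eval_simps if_distrib[of "eval x"] cong: if_cong)
  qed
  have dg: "dderiv n x v (g ! 0) = - 2 * (\<Sum>i<n. x i * v i)" for v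
    unfolding dderiv_def sum_distrib_left by (intro sum.cong) (simp_all add: pd)
  have df: "dderiv n x v f = (\<Sum>i<n. D i * v i)" for v by (simp add: dderiv_def D_def)
  consider "s < 1" | "s = 1" using feasible[of 0] g0 g by force
  then show ?thesis
  proof cases
    case 1
    then have "dderiv n x (\<lambda>i. - D i) f \<ge> 0" using g0 g by (intro dderiv_nonneg) auto
    then have "(\<Sum>i<n. (D i)\<^sup>2) \<le> 0" by (simp add: df power2_eq_square sum_negf)
    then have "D i = 0" if "i < n" for i
      using that sum_nonneg_eq_0_iff[of "{..<n}" "\<lambda>i. (D i)\<^sup>2"] by (simp add: sum_nonneg antisym)
    then show ?thesis by (intro exI[of _ "\<lambda>_. 0"]) (simp add: D_def)
  next
    case 2
    define b where "b = (\<Sum>i<n. D i * x i)"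
    have xx: "(\<Sum>i<n. x i * x i) = 1" using 2 by (simp add: s_def power2_eq_square)
    have "b\<^sup>2 - (\<Sum>i<n. (D i)\<^sup>2) - \<eta> * b \<ge> 0" if "\<eta> > 0" for \<eta>
    proof -
      \<comment> \<open>The tangential part of \<open>- D\<close>, tilted inwards by
        \<open>\<eta>\<close> because \<open>dderiv_nonneg\<close> requires a strictly positive
        derivative of the active constraint. Then \<open>\<eta>\<close> tends to 0.\<close>
      let ?v = "\<lambda>i. - D i + b * x i - \<eta> * x i"
      have "(\<Sum>i<n. x i * ?v i) = - b + b * (\<Sum>i<n. x i * x i) - \<eta> * (\<Sum>i<n. x i * x i)"
        by (simp add: b_def sum.distrib sum_subtractf sum_negf sum_distrib_left algebra_simps)
      then have "dderiv n x ?v (g ! 0) > 0" using xx that by (simp add: dg)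
      then have "dderiv n x ?v f \<ge> 0" using g0 g 2 by (intro dderiv_nonneg) auto
      moreover have "dderiv n x ?v f = - (\<Sum>i<n. (D i)\<^sup>2) + b * (\<Sum>i<n. D i * x i) - \<eta> * (\<Sum>i<n. D i * x i)"
        by (simp add: df sum.distrib sum_subtractf sum_negf sum_distrib_left algebra_simps power2_eq_square)
      ultimately show ?thesis by (simp add: b_def[symmetric] power2_eq_square)
    qed
    then have lim: "(\<Sum>i<n. (D i)\<^sup>2) \<le> b\<^sup>2 + \<eta> * \<bar>b\<bar>" if "\<eta> > 0" for \<eta>
      using that by (smt (verit) abs_ge_minus_self mult_left_mono mult_minus_right)
    have "(\<Sum>i<n. (D i)\<^sup>2) \<le> b\<^sup>2"
    proof (rule field_le_epsilon)
      fix e :: real assume "e > 0"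
      have "e / (\<bar>b\<bar> + 1) * \<bar>b\<bar> \<le> e" using \<open>e > 0\<close> by (simp add: field_simps)
      then show "(\<Sum>i<n. (D i)\<^sup>2) \<le> b\<^sup>2 + e" using lim[of "e / (\<bar>b\<bar> + 1)"] \<open>e > 0\<close> by simp
    qed
    moreover have "(\<Sum>i<n. (D i - b * x i)\<^sup>2) = (\<Sum>i<n. (D i)\<^sup>2) - 2 * b * (\<Sum>i<n. D i * x i) + b\<^sup>2 * (\<Sum>i<n. x i * x i)"
      by (simp add: power2_eq_square algebra_simps sum.distrib sum_subtractf sum_distrib_left)
    ultimately have "(\<Sum>i<n. (D i - b * x i)\<^sup>2) \<le> 0" by (simp add: xx b_def[symmetric] power2_eq_square)
    then have "D i = b * x i" if "i < n" for i
      using that sum_nonneg_eq_0_iff[of "{..<n}" "\<lambda>i. (D i - b * x i)\<^sup>2"] by (simp add: sum_nonneg antisym)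
    \<comment> \<open>The factor \<open>- b / 2\<close> reflects that the constraint has gradient
      \<open>- 2 x\<close>.\<close>
    then show ?thesis using 2 g g0 pd by (intro exI[of _ "\<lambda>_. - b / 2"]) (auto simp: D_def)
  qed
qed

text \<open>The coordinates decouple: where constraint \<open>i\<close> is inactive, moving
  coordinate \<open>i\<close> both ways shows that the partial derivative vanishes.\<close>

lemma multipliers_box:
  assumes g: "g = map (\<lambda>i. 1 - (Var i)\<^sup>2) [0..<n]"
  shows "\<exists>\<mu>. (\<forall>i<n. eval x (pdiff i f) = (\<Sum>j<length g. \<mu> j * eval x (pdiff i (g ! j))))
    \<and> (\<forall>j<length g. \<mu> j * eval x (g ! j) = 0)"
proof -
  define D where "D i = eval x (pdiff i f)" for i
  have gj: "eval y (g ! j) = 1 - (y j)\<^sup>2" if "j < n" for y j using g that by (simp add: eval_simps)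
  have pd: "eval x (pdiff i (g ! j)) = (if j = i then - 2 * x i else 0)" if "j < n" for i j
    using g that by (auto simp: pdiff_simps eval_simps)
  have D0: "D i = 0" if i: "i < n" "(x i)\<^sup>2 \<noteq> 1" for i
  proof -
    have "D i * c \<ge> 0" for c
    proof -
      have "dderiv n x (\<lambda>k. if k = i then c else 0) f \<ge> 0"
      proof (rule dderiv_nonneg)
        fix j assume "j < length g"
        then have j: "j < n" using g by simp
        show "eval x (g ! j) > 0 \<or> eval x (g ! j) = 0 \<and> dderiv n x (\<lambda>k. if k = i then c else 0) (g ! j) > 0
          \<or> (\<forall>t. eval (\<lambda>k. x k + t * (if k = i then c else 0)) (g ! j) = eval x (g ! j))"
          using gj[OF j] feasible[of j] j g i by (cases "j = i") auto
      qed
      moreover have "dderiv n x (\<lambda>k. if k = i then c else 0) f = (\<Sum>k<n. if k = i then D i * c else 0)"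
        unfolding dderiv_def by (intro sum.cong) (auto simp: D_def)
      ultimately show ?thesis using i by simp
    qed
    from this[of "- D i"] have "(D i)\<^sup>2 \<le> 0" by (simp add: power2_eq_square)
    then show ?thesis by simp
  qed
  \<comment> \<open>At \<open>x j = 0\<close> the quotient is 0 by convention, which is the right
    value: the constraint is inactive there and \<open>D j = 0\<close>.\<close>
  let ?\<mu> = "\<lambda>j. - D j / (2 * x j)"
  have "D i = (\<Sum>j<length g. ?\<mu> j * eval x (pdiff i (g ! j)))" if "i < n" for i
  proof -
    have "(\<Sum>j<length g. ?\<mu> j * eval x (pdiff i (g ! j))) = (\<Sum>j<n. if j = i then D i else 0)"
    proof (rule sum.cong)
      fix j assume "j \<in> {..<n}"
      then have j: "j < n" by simp
      show "?\<mu> j * eval x (pdiff i (g ! j)) = (if j = i then D i else 0)"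
      proof (cases "x j = 0")
        case True
        then have "D j = 0" by (intro D0[OF j]) simp
        then show ?thesis by (auto simp: pd[OF j])
      next
        case False
        then show ?thesis by (auto simp: pd[OF j])
      qed
    qed (use g in simp)
    then show ?thesis using that by simp
  qed
  moreover have "?\<mu> j * eval x (g ! j) = 0" if "j < length g" for j
  proof -
    have j: "j < n" using that g by simp
    show ?thesis by (cases "(x j)\<^sup>2 = 1") (simp_all add: gj[OF j] D0[OF j])
  qed
  ultimately show ?thesis
    unfolding D_def[symmetric] by (intro exI[of _ ?\<mu>] conjI allI impI)
qed

text \<open>\<open>h_FJ\<close> puts no sign condition on multipliers, so it is enough to test
  directions that keep the zero coordinates of \<open>x\<close> fixed. On the other coordinates the
  partial derivatives share a common value \<open>- m\<close>, and \<open>m\<close> is the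
  multiplier of the last constraint.\<close>

lemma multipliers_simplex:
  assumes g: "g = map Var [0..<n] @ [1 - (\<Sum>i<n. Var i)]"
  shows "\<exists>\<mu>. (\<forall>i<n. eval x (pdiff i f) = (\<Sum>j<length g. \<mu> j * eval x (pdiff i (g ! j))))
    \<and> (\<forall>j<length g. \<mu> j * eval x (g ! j) = 0)"
proof -
  define D where "D i = eval x (pdiff i f)" for i
  define s where "s = (\<Sum>i<n. x i)"
  have gj: "eval y (g ! j) = y j" if "j < n" for y j using g that by (simp add: nth_append eval_simps)
  have gn: "eval y (g ! n) = 1 - (\<Sum>i<n. y i)" for y using g by (simp add: nth_append eval_simps)
  have pd: "eval x (pdiff i (g ! n)) = - 1" if "i < n" for i
    using g that by (simp add: nth_append pdiff_simps eval_simps)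
  have pdj: "eval x (pdiff i (g ! j)) = (if j = i then 1 else 0)" if "j < n" for i j
    using g that by (auto simp add: nth_append pdiff_simps eval_simps)
  have x0: "x i \<ge> 0" if "i < n" for i using feasible[of i] gj[OF that] that g by simp
  have dg: "dderiv n x v (g ! n) = - (\<Sum>i<n. v i)" for v
    unfolding dderiv_def sum_negf[symmetric] by (intro sum.cong) (simp_all add: pd)
  have df: "dderiv n x v f = (\<Sum>i<n. D i * v i)" for v by (simp add: dderiv_def D_def)
  have dir: "(\<Sum>i<n. D i * v i) \<ge> 0"
    if v: "\<And>i. i < n \<Longrightarrow> x i = 0 \<Longrightarrow> v i = 0" and vn: "s < 1 \<or> (\<Sum>i<n. v i) < 0" for v
    unfolding df[symmetric]
  proof (rule dderiv_nonneg)
    fix j assume "j < length g"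
    then consider "j < n" | "j = n" using g by force
    then show "eval x (g ! j) > 0 \<or> eval x (g ! j) = 0 \<and> dderiv n x v (g ! j) > 0
      \<or> (\<forall>t. eval (\<lambda>k. x k + t * v k) (g ! j) = eval x (g ! j))"
    proof cases
      case 1
      then show ?thesis using v[of j] x0[of j] gj[of j] by auto
    next
      case 2
      then show ?thesis using vn feasible[of n] g gn[of x] dg by (auto simp: s_def)
    qed
  qed
  obtain m where m: "m * (1 - s) = 0" "\<And>i. i < n \<Longrightarrow> x i \<noteq> 0 \<Longrightarrow> D i + m = 0"
  proof (cases "s < 1")
    case True
    have D0: "D i = 0" if i: "i < n" "x i \<noteq> 0" for i
    proof -
      have "(\<Sum>k<n. D k * (if k = i then - D i else 0)) \<ge> 0" using True i by (intro dir) auto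
      also have "(\<Sum>k<n. D k * (if k = i then - D i else 0)) = (\<Sum>k<n. if k = i then - (D i * D i) else 0)"
        by (intro sum.cong) auto
      finally have "(D i)\<^sup>2 \<le> 0" using i by (simp add: power2_eq_square)
      then show ?thesis by simp
    qed
    show ?thesis by (rule that[of 0]) (simp_all add: D0)
  next
    case False
    then have s: "s = 1" using feasible[of n] gn[of x] g by (simp add: s_def)
    have "\<exists>l<n. x l \<noteq> 0"
    proof (rule ccontr)
      assume "\<not> ?thesis"
      then have "s = 0" unfolding s_def by (intro sum.neutral) auto
      then show False using s by simp
    qed
    then obtain l where l: "l < n" "x l \<noteq> 0" by blast
    have Dl: "D i = D l" if i: "i < n" "x i \<noteq> 0" for i
    proof -
      have "c * (D i - D l) - \<eta> * D l \<ge> 0" if "\<eta> > 0" for c \<eta>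
      proof -
        \<comment> \<open>Mass \<open>c\<close> moves from coordinate \<open>l\<close> to
          \<open>i\<close>, with an extra loss \<open>\<eta>\<close> that makes the active last
          constraint increase strictly.\<close>
        let ?v = "\<lambda>k. (if k = i then c else 0) - (if k = l then c + \<eta> else 0)"
        have "(\<Sum>k<n. ?v k) < 0" using i l that by (simp add: sum_subtractf)
        then have "(\<Sum>k<n. D k * ?v k) \<ge> 0" using i l by (intro dir) auto
        moreover have "(\<Sum>k<n. D k * ?v k) = (\<Sum>k<n. if k = i then D i * c else 0) - (\<Sum>k<n. if k = l then D l * (c + \<eta>) else 0)"
          unfolding sum_subtractf[symmetric] by (intro sum.cong) (auto simp: algebra_simps)
        ultimately show ?thesis using i l by (simp add: algebra_simps)
      qed
      note * = this
      have "(D i - D l)\<^sup>2 \<le> 0"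
      proof (rule field_le_epsilon)
        fix e :: real assume "e > 0"
        have "- (D l) * (e / (\<bar>D l\<bar> + 1)) \<le> e"
        proof -
          have "- (D l) * (e / (\<bar>D l\<bar> + 1)) \<le> \<bar>D l\<bar> * (e / (\<bar>D l\<bar> + 1))"
            using \<open>e > 0\<close> by (intro mult_right_mono) auto
          also have "\<dots> \<le> e" using \<open>e > 0\<close> by (simp add: field_simps)
          finally show ?thesis .
        qed
        \<comment> \<open>With \<open>c\<close> the negative of the difference, the inequality
          bounds its square by \<open>- \<eta> * D l\<close>, and \<open>\<eta>\<close> is scaled to
          keep this below \<open>e\<close>.\<close>
        then show "(D i - D l)\<^sup>2 \<le> 0 + e"
          using *[of "e / (\<bar>D l\<bar> + 1)" "- (D i - D l)"] \<open>e > 0\<close>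
          by (simp add: power2_eq_square algebra_simps)
      qed
      then show ?thesis by simp
    qed
    show ?thesis by (rule that[of "- D l"]) (simp_all add: s Dl)
  qed
  let ?\<mu> = "\<lambda>j. if j < n then D j + m else m"
  have len: "length g = Suc n" using g by simp
  have "D i = (\<Sum>j<length g. ?\<mu> j * eval x (pdiff i (g ! j)))" if "i < n" for i
  proof -
    have "(\<Sum>j<n. ?\<mu> j * eval x (pdiff i (g ! j))) = (\<Sum>j<n. if j = i then D i + m else 0)"
      by (intro sum.cong) (auto simp: pdj)
    then show ?thesis using that pd by (simp add: len)
  qed
  moreover have "?\<mu> j * eval x (g ! j) = 0" if "j < length g" for j
  proof (cases "j < n")
    case True
    then show ?thesis using m(2)[of j] by (cases "x j = 0") (simp_all add: gj)
  next
    case False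
    then have "j = n" using that len by simp
    then show ?thesis using m(1) by (simp add: gn s_def)
  qed
  ultimately show ?thesis
    unfolding D_def[symmetric] by (intro exI[of _ ?\<mu>] conjI allI impI)
qed

text \<open>The multipliers \<open>(1, \<mu>)\<close>, with 1 belonging to \<open>f\<close>, satisfy
  the homogeneous relations; dividing them by their Euclidean norm \<open>r\<close> places them on
  the sphere of the last relation.\<close>

lemma ex_FJ_point:
  assumes "admissible n g"
  shows "\<exists>z. (\<forall>i<n. z i = x i) \<and> (\<forall>p\<in>set (h_FJ n f g). eval z p = 0)"
proof -
  have "\<exists>\<mu>. (\<forall>i<n. eval x (pdiff i f) = (\<Sum>j<length g. \<mu> j * eval x (pdiff i (g ! j))))
    \<and> (\<forall>j<length g. \<mu> j * eval x (g ! j) = 0)"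
    using assms unfolding admissible_def
    by (elim disjE) (rule multipliers_ball multipliers_box multipliers_simplex; assumption)+
  then obtain \<mu> where "\<forall>i<n. eval x (pdiff i f) = (\<Sum>j<length g. \<mu> j * eval x (pdiff i (g ! j)))"
    "\<forall>j<length g. \<mu> j * eval x (g ! j) = 0"
    by (elim exE conjE)
  note \<mu> = this[rule_format]
  define r where "r = sqrt (1 + (\<Sum>j<length g. (\<mu> j)\<^sup>2))"
  define \<nu> where "\<nu> k = (case k of 0 \<Rightarrow> 1 / r | Suc j \<Rightarrow> \<mu> j / r)" for k
  define z where "z i = (if i < n then x i else \<nu> (i - n))" for i
  have "1 + (\<Sum>j<length g. (\<mu> j)\<^sup>2) > 0" by (intro add_pos_nonneg sum_nonneg) auto
  then have r: "r > 0" "r\<^sup>2 = 1 + (\<Sum>j<length g. (\<mu> j)\<^sup>2)" by (simp_all add: r_def)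
  have zx: "eval z p = eval x p" if "p \<in> polys n" for p by (rule eval_cong[OF that]) (simp add: z_def)
  have zL: "eval z (Lam n j) = \<nu> j" for j by (simp add: Lam_def eval_simps z_def)
  have gp: "g ! j \<in> polys n" if "j < length g" for j by (rule subsetD[OF g nth_mem[OF that]])
  have "eval z (Lam n 0 * pdiff i f - (\<Sum>j<length g. Lam n (j + 1) * pdiff i (g ! j))) = 0" if "i < n" for i
  proof -
    have "(\<Sum>j<length g. eval z (Lam n (j + 1) * pdiff i (g ! j))) = (\<Sum>j<length g. (1 / r) * (\<mu> j * eval x (pdiff i (g ! j))))"
      by (intro sum.cong) (auto simp: eval_simps zL \<nu>_def zx pdiff_polys gp)
    also have "\<dots> = (1 / r) * eval x (pdiff i f)" unfolding \<mu>(1)[OF that] sum_distrib_left ..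
    finally have "(\<Sum>j<length g. eval z (Lam n (j + 1) * pdiff i (g ! j))) = eval z (Lam n 0 * pdiff i f)"
      by (simp add: eval_simps(2) zL \<nu>_def zx pdiff_polys f)
    then show ?thesis by (simp only: eval_simps(6,8) diff_self)
  qed
  moreover have "eval z (Lam n (j + 1) * g ! j) = 0" if "j < length g" for j
    using \<mu>(2)[OF that] by (simp add: eval_simps zL \<nu>_def zx gp that)
  moreover have "eval z (1 - (\<Sum>j\<le>length g. (Lam n j)\<^sup>2)) = 0"
  proof -
    have "(\<Sum>j\<le>length g. (\<nu> j)\<^sup>2) = (1 + (\<Sum>j<length g. (\<mu> j)\<^sup>2)) / r\<^sup>2"
      by (simp add: sum.atMost_shift \<nu>_def power_divide add_divide_distrib sum_divide_distrib)
    also have "\<dots> = 1" unfolding r(2)[symmetric] using r(1) by simp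
    finally show ?thesis by (simp add: eval_simps zL)
  qed
  ultimately have "\<forall>p\<in>set (h_FJ n f g). eval z p = 0" unfolding h_FJ_def by auto
  moreover have "\<forall>i<n. z i = x i" by (simp add: z_def)
  ultimately show ?thesis by blast
qed

end

section \<open>Weak duality and conclusion\<close>

lemma eval_Q_plus_I_nonneg:
  assumes "p \<in> Q N k g + I N k h"
    and g: "\<And>j. j < length g \<Longrightarrow> eval z (g ! j) \<ge> 0" and h: "\<And>q. q \<in> set h \<Longrightarrow> eval z q = 0"
  shows "eval z p \<ge> 0"
proof -
  obtain a b where ab: "p = a + b" "a \<in> Q N k g" "b \<in> I N k h" using assms(1) by (rule set_plus_elim)
  have "eval z a \<ge> 0"
  proof -
    obtain \<sigma>0 \<sigma> where a: "a = \<sigma>0 + (\<Sum>j<length g. \<sigma> j * g ! j)" "\<sigma>0 \<in> SOS N"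
      "\<forall>j<length g. \<sigma> j \<in> SOS N \<and> tdeg (\<sigma> j * g ! j) \<le> 2 * k"
      using ab(2) unfolding Q_def by blast
    have "eval z a = eval z \<sigma>0 + (\<Sum>j<length g. eval z (\<sigma> j) * eval z (g ! j))"
      by (simp add: a(1) eval_simps)
    also have "\<dots> \<ge> 0"
      using a by (auto intro!: add_nonneg_nonneg sum_nonneg mult_nonneg_nonneg eval_SOS[of _ N] g)
    finally show ?thesis .
  qed
  moreover have "eval z b = 0"
    using ab(3) unfolding I_def by (auto simp: eval_simps h)
  ultimately show ?thesis using ab(1) by (simp add: eval_simps)
qed

text \<open>Points of \<open>S n g\<close> are extensional, whereas the perturbed points used for
  multipliers are arbitrary functions. Restriction to \<open>{..<n}\<close> mediates, since
  polynomials in \<open>polys n\<close> do not see it.\<close>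

lemma minimizer_of_global_minimizer:
  assumes f: "f \<in> polys n" and g: "set g \<subseteq> polys n" and x: "global_minimizer n f g x"
  shows "minimizer n f g x"
proof
  show "eval x (g ! j) \<ge> 0" if "j < length g" for j
    using x that by (simp add: global_minimizer_def S_def)
  fix y assume y: "\<And>j. j < length g \<Longrightarrow> eval y (g ! j) \<ge> 0"
  let ?y = "restrict y {..<n}"
  have yy: "eval ?y p = eval y p" if "p \<in> polys n" for p by (rule eval_cong[OF that]) simp
  have "eval ?y (g ! j) \<ge> 0" if "j < length g" for j
    using yy[OF subsetD[OF g nth_mem[OF that]]] y[OF that] by simp
  then have "?y \<in> S n g" by (simp add: S_def)
  then have "eval x f \<le> eval ?y f" using x unfolding global_minimizer_def by blast
  then show "eval x f \<le> eval y f" by (simp only: yy[OF f])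
qed (use f g in auto)

theorem corollary1:
  fixes n :: nat and f :: mpoly and g :: "mpoly list"
  assumes "n \<ge> 1" and "length g \<ge> 1"
    and "f \<in> polys n" and "set g \<subseteq> polys n"
    and "\<exists>x. global_minimizer n f g x"
    and "g = [1 - (\<Sum>i<n. (Var i)\<^sup>2)]
       \<or> g = map (\<lambda>i. 1 - (Var i)\<^sup>2) [0..<n]
       \<or> g = map Var [0..<n] @ [1 - (\<Sum>i<n. Var i)]"
  shows "\<exists>k::nat. rho n k f g (h_FJ n f g) = fstar n f g"
proof -
  let ?N = "nz n g" and ?h = "h_FJ n f g"
  obtain x where x: "global_minimizer n f g x" using assms(5) by blast
  interpret minimizer n f g x by (rule minimizer_of_global_minimizer[OF assms(3,4) x])
  have adm: "admissible n g" using assms(6) by (simp add: admissible_def)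
  have fN: "f \<in> polys ?N" by (rule polys_mono[OF _ f]) (simp add: nz_def)
  obtain cs where cs: "set cs \<subseteq> {eval x f..}" "- ((\<Prod>c\<leftarrow>cs. f - Const c)\<^sup>2) \<in> cert ?N g ?h"
  proof -
    have "\<exists>cs. set cs \<subseteq> {eval x f..} \<and> - ((\<Prod>c\<leftarrow>cs. f - Const c)\<^sup>2) \<in> cert ?N g ?h"
      by (rule ex_cert_product[OF f g adm]) (rule min)
    then show ?thesis using that by (elim exE conjE)
  qed
  obtain d where d: "\<And>\<epsilon>. \<epsilon> > 0 \<Longrightarrow> f - Const (eval x f - \<epsilon>) \<in> Q ?N d g + I ?N d ?h"
  proof -
    obtain q k where "- ((f - Const (eval x f) - (poly (map_poly Const q) f)\<^sup>2) ^ (2 ^ Suc k)) \<in> cert ?N g ?h"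
      using cert_power[OF fN cs] by (elim exE)
    from uniform_order[OF fN this] obtain d where
      d: "\<forall>\<epsilon>>0. f - Const (eval x f - \<epsilon>) \<in> Q ?N d g + I ?N d ?h" by (elim exE)
    show ?thesis by (rule that[of d]) (rule d[rule_format])
  qed
  have star: "fstar n f g = ereal (eval x f)"
    unfolding fstar_def
  proof (rule antisym)
    show "(INF y\<in>S n g. ereal (eval y f)) \<le> ereal (eval x f)"
      by (rule INF_lower) (use x in \<open>simp add: global_minimizer_def\<close>)
    show "ereal (eval x f) \<le> (INF y\<in>S n g. ereal (eval y f))"
      by (rule INF_greatest) (use x in \<open>simp add: global_minimizer_def\<close>)
  qed
  \<comment> \<open>The ideal part vanishes at \<open>z\<close> and \<open>f\<close> keeps its
    minimal value there, which bounds every feasible \<open>\<xi>\<close>.\<close>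
  obtain z where z: "\<forall>i<n. z i = x i" "\<forall>p\<in>set ?h. eval z p = 0" using ex_FJ_point[OF adm] by blast
  have zx: "eval z p = eval x p" if "p \<in> polys n" for p by (rule eval_cong[OF that]) (simp add: z)
  have "rho n d f g ?h = ereal (eval x f)"
  proof (rule antisym)
    show "rho n d f g ?h \<le> ereal (eval x f)" unfolding rho_def
    proof (rule SUP_least)
      fix \<xi> assume "\<xi> \<in> {\<xi>. f - Const \<xi> \<in> Q ?N d g + I ?N d ?h}"
      then have *: "f - Const \<xi> \<in> Q ?N d g + I ?N d ?h" by simp
      have "eval z (f - Const \<xi>) \<ge> 0"
      proof (rule eval_Q_plus_I_nonneg[OF *])
        show "eval z (g ! j) \<ge> 0" if "j < length g" for j
          using feasible[OF that] zx[OF subsetD[OF g nth_mem[OF that]]] by simp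
        show "eval z q = 0" if "q \<in> set ?h" for q using z(2) that by (rule bspec)
      qed
      then show "ereal \<xi> \<le> ereal (eval x f)" using zx[OF f] by (simp add: eval_simps)
    qed
    show "ereal (eval x f) \<le> rho n d f g ?h"
    \<comment> \<open>Only \<open>eval x f - \<epsilon>\<close> is known to be feasible, but at the
      same order \<open>d\<close> for all \<open>\<epsilon>\<close>; the supremum closes the
      gap.\<close>
    proof (rule ereal_le_epsilon2)
      fix \<epsilon> :: real assume "\<epsilon> > 0"
      then have "ereal (eval x f - \<epsilon>) \<le> rho n d f g ?h"
        unfolding rho_def by (intro SUP_upper CollectI d)
      then show "ereal (eval x f) \<le> rho n d f g ?h + ereal \<epsilon>"
        using add_right_mono[of "ereal (eval x f - \<epsilon>)" _ "ereal \<epsilon>"] by simp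
    qed
  qed
  then show ?thesis unfolding star by (rule exI)
qed

end
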